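(* Consider the fixed-design linear model, estimators and assumptions described in the context. (1) If Assumptions 1–5 hold, then $$\mathrm{Prob}\big(\widehat{\mathcal N}_{b_n}\neq \mathcal N_{b_n}\big)=O\big(n^{\alpha_p+m\nu_b-m\eta}\big)\quad\text{and}\quad \max_{i=1,\dots,p_1}|\widehat\gamma_i-\gamma_i| = O_p\big(|\mathcal M|^{1/m}\, n^{-\eta}\big).$$ (2) If Assumptions 1–6 hold, then $|\widehat\sigma^2-\sigma^2| = O_p(n^{-\alpha_\sigma})$.
   Context: Model: $y=X\beta+\epsilon$, $y\in\mathbb R^n$, with deterministic $n\times p$ design matrix $X=(x_{ij})$ of rank $r$, unknown $\beta\in\mathbb R^p$, errors $\epsilon=(\epsilon_1,\dots,\epsilon_n)^T$. All quantities ($p,r,X,\beta,M,p_1,\rho_n,b_n,\dots$) may depend on $n$; all asymptotic statements are as $n\to\infty$. $M=(m_{ij})$ is a known $p_1\times p$ matrix and $\gamma=(\gamma_1,\dots,\gamma_{p_1})^T=M\beta$. Let $X=P\Lambda Q^T$ be a thin SVD: $P=(p_{lk})$ is $n\times r$, $Q=(q_{jk})$ is $p\times r$, $P^TP=Q^TQ=I_r$, $\Lambda=\mathrm{diag}(\lambda_1,\dots,\lambda_r)$ with $\lambda_1\ge\dots\ge\lambda_r>0$. Let $Q_\perp$ be a $p\times(p-r)$ matrix with $Q_\perp^TQ_\perp=I_{p-r}$, $Q^TQ_\perp=0$, $QQ^T+Q_\perp Q_\perp^T=I_p$. Set $\zeta=Q^T\beta$, $\theta=(\theta_1,\dots,\theta_p)^T=QQ^T\beta$,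 $\theta_\perp=(\theta_{\perp,1},\dots,\theta_{\perp,p})^T=Q_\perp Q_\perp^T\beta$ (with $\theta_\perp=0$ if $r=p$). Given a ridge parameter $\rho_n>0$ and threshold $b_n>0$, let $\mathcal N_{b_n}=\{i:|\theta_i|>b_n\}$, $c_{ik}=\sum_{j\in\mathcal N_{b_n}}m_{ij}q_{jk}$ ($i\le p_1,k\le r$), $\mathcal M=\{i:\sum_{k=1}^r c_{ik}^2>0\}$, $w_k=\frac{\lambda_k}{\lambda_k^2+\rho_n}+\frac{\rho_n\lambda_k}{(\lambda_k^2+\rho_n)^2}$, $\tau_i=\sqrt{\sum_{k=1}^r c_{ik}^2w_k^2+1/n}$. Estimators: $\widetilde\theta^\star=(X^TX+\rho_nI_p)^{-1}X^Ty$, $\widetilde\theta=(\widetilde\theta_1,\dots,\widetilde\theta_p)^T=\widetilde\theta^\star+\rho_nQ(\Lambda^2+\rho_nI_r)^{-1}Q^T\widetilde\theta^\star$, $\widehat{\mathcal N}_{b_n}=\{i:|\widetilde\theta_i|>b_n\}$, $\widehat\theta_i=\widetilde\theta_i\mathbf 1_{i\in\widehat{\mathcal N}_{b_n}}$, $\widehat\gamma=M\widehat\theta$, $\widehat\sigma^2=\frac1n\sum_{i=1}^n(y_i-\sum_{j=1}^px_{ij}\widehat\theta_j)^2$, and $\sigma^2=\mathbf E\epsilon_1^2$. Assumption 1: $X$ is deterministic; there are constants $c_\lambda,C_\lambda>0$, $0<\eta\le1/2$ with $C_\lambda n^{1/2}\ge\lambda_1\ge\dots\ge\lambda_r\ge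 c_\lambda n^{\eta}$; and $\|\theta\|_2=O(n^{\alpha_\theta})$ with $0<\alpha_\theta<3\eta$. Assumption 2: $\rho_n=O(n^{2\eta-\delta})$ for a constant $\delta$ with $\frac{\eta+\alpha_\theta}{2}<\delta<2\eta$. Assumption 3: $\epsilon_1,\dots,\epsilon_n$ are i.i.d., $\mathbf E\epsilon_1=0$, $\mathbf E|\epsilon_1|^m<\infty$ for some $m>4$. Assumption 4: $p=O(n^{\alpha_p})$ with $\alpha_p\in[0,m\eta)$; $b_n=C_bn^{-\nu_b}$ with constants $C_b,\nu_b>0$ and $\nu_b+\alpha_p/m-\eta<0$; there is a constant $0<c_b<1$ with $\max_{i\notin\mathcal N_{b_n}}|\theta_i|\le c_bb_n$ and $\min_{i\in\mathcal N_{b_n}}|\theta_i|\ge b_n/c_b$. Assumption 5: $\mathcal M\neq\emptyset$, $|\mathcal M|=O(n^{\alpha_{\mathcal M}})$ with $\alpha_{\mathcal M}<m\eta$; there are constants with $0<c_{\mathcal M}<\sum_{k=1}^rc_{ik}^2\le C_{\mathcal M}$ for all $i\in\mathcal M$; and $\max_{i\le p_1}|\sum_{j\notin\mathcal N_{b_n}}m_{ij}\theta_j|=o(1/\sqrt{n\log n})$, $\max_{i\le p_1}|\sum_{j=1}^pm_{ij}\theta_{\perp,j}|=o(1/\sqrt{n\log n})$. Assumption 6: there is a constant $0<\alpha_\sigma\le\eta$ with $n^{-\nu_b}\sum_{j\notin\mathcal N_{b_n}}|\theta_j|=O(n^{-\alpha_\sigma})$ and $\sqrt{|\mathcal N_{b_n}|}/n^{\eta}=O(n^{-\alpha_\sigma})$.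 *)

theory Defs
  imports "HOL-Probability.Probability" "HOL-Library.Landau_Symbols"
    "Jordan_Normal_Form.Gauss_Jordan_Elimination"
begin

text \<open>Matrices and vectors are Jordan_Normal_Form matrices/vectors; indices start at 0
  (paper index i corresponds to index i-1 here).\<close>

definition minv :: "real mat \<Rightarrow> real mat" where
  "minv A = the (mat_inverse A)"

definition diagm :: "nat \<Rightarrow> (nat \<Rightarrow> real) \<Rightarrow> real mat" where
  "diagm r lam = mat r r (\<lambda>(i,j). if i = j then lam i else 0)"

definition vnorm :: "real vec \<Rightarrow> real" where
  "vnorm v = sqrt (\<Sum>i<dim_vec v. (v $ i)^2)"

definition proj :: "real mat \<Rightarrow> real vec \<Rightarrow> real vec" where
  "proj Q \<beta> = (Q * transpose_mat Q) *\<^sub>v \<beta>"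

definition Nset :: "real \<Rightarrow> real vec \<Rightarrow> nat set" where
  "Nset b \<theta> = {i. i < dim_vec \<theta> \<and> \<bar>\<theta> $ i\<bar> > b}"

definition ccoef :: "real mat \<Rightarrow> real mat \<Rightarrow> nat set \<Rightarrow> nat \<Rightarrow> nat \<Rightarrow> real" where
  "ccoef Mm Q N i k = (\<Sum>j\<in>N. Mm $$ (i,j) * Q $$ (j,k))"

definition Mset :: "real mat \<Rightarrow> real mat \<Rightarrow> nat set \<Rightarrow> nat set" where
  "Mset Mm Q N = {i. i < dim_row Mm \<and> (\<Sum>k<dim_col Q. (ccoef Mm Q N i k)^2) > 0}"

text \<open>Response vector y = X beta + (eps_1,...,eps_n); eps l corresponds to epsilon_{l+1}.\<close>
definition yvec :: "real mat \<Rightarrow> real vec \<Rightarrow> (nat \<Rightarrow> 'a \<Rightarrow> real) \<Rightarrow> 'a \<Rightarrow> real vec" where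
  "yvec X \<beta> eps \<omega> = X *\<^sub>v \<beta> + vec (dim_row X) (\<lambda>l. eps l \<omega>)"

definition ridge :: "real mat \<Rightarrow> real \<Rightarrow> real vec \<Rightarrow> real vec" where
  "ridge X \<rho> y = minv (transpose_mat X * X + \<rho> \<cdot>\<^sub>m 1\<^sub>m (dim_col X)) *\<^sub>v (transpose_mat X *\<^sub>v y)"

text \<open>Bias-corrected estimator theta~ = theta~* + rho Q (Lambda^2 + rho I_r)^{-1} Q^T theta~*.\<close>
definition theta_tilde :: "real mat \<Rightarrow> real mat \<Rightarrow> real mat \<Rightarrow> real \<Rightarrow> real vec \<Rightarrow> real vec" where
  "theta_tilde X Q Lam \<rho> y =
     (let ts = ridge X \<rho> y in
      ts + \<rho> \<cdot>\<^sub>v ((Q * minv (Lam * Lam + \<rho> \<cdot>\<^sub>m 1\<^sub>m (dim_col Q)) * transpose_mat Q) *\<^sub>v ts))"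

definition theta_hat :: "real \<Rightarrow> real vec \<Rightarrow> real vec" where
  "theta_hat b \<theta>t = vec (dim_vec \<theta>t) (\<lambda>i. if i \<in> Nset b \<theta>t then \<theta>t $ i else 0)"

definition sigma_hat2 :: "real mat \<Rightarrow> real vec \<Rightarrow> real vec \<Rightarrow> real" where
  "sigma_hat2 X y \<theta>h = (1 / real (dim_row X)) * (\<Sum>l<dim_row X. (y $ l - (X *\<^sub>v \<theta>h) $ l)^2)"

definition bigOp :: "'a measure \<Rightarrow> (nat \<Rightarrow> 'a \<Rightarrow> real) \<Rightarrow> (nat \<Rightarrow> real) \<Rightarrow> bool" where
  "bigOp PS Z a \<longleftrightarrow> (\<forall>e>0. \<exists>C N. \<forall>n\<ge>N.
      measure PS {\<omega> \<in> space PS. \<bar>Z n \<omega>\<bar> > C * a n} \<le> e)"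

end

theory Submission
  imports Defs "Jordan_Normal_Form.Determinant"
begin

text \<open>
  In the coordinates of the singular value decomposition the estimation error is explicit:
  \<open>\<theta>~ - \<theta> = Q (- s \<zeta> + w P\<^sup>T \<epsilon>)\<close> with \<open>s\<^sub>k = \<rho>\<^sup>2 / (\<lambda>\<^sub>k\<^sup>2 + \<rho>)\<^sup>2\<close>. Assumptions 1 and 2 make the bias of
  every linear functional with bounded coefficients \<open>O(n powr (- \<eta>))\<close>, and the noise is a linear
  combination of the errors whose coefficient vector has norm \<open>O(n powr (- \<eta>))\<close>. Its \<open>m\<close>-th moment
  is therefore \<open>O(n powr (- m \<eta>))\<close>, and Markov's inequality with a union bound over the \<open>p\<close>
  coordinates, respectively over the rows in \<open>\<M>\<close>, gives selection consistency and the rate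
  for \<open>\<gamma>\<close>. For the variance, the fitted residual is \<open>\<epsilon> - X d + X \<theta>'\<close>, where \<open>d\<close> is the error
  on the selected coordinates and \<open>\<theta>'\<close> the deterministic part of \<open>\<theta>\<close> below the threshold.
  The cross term with \<open>\<theta>'\<close> has to be bounded through its variance: the Cauchy--Schwarz
  inequality would lose a factor \<open>n powr (\<alpha>\<^sub>\<sigma> / 2)\<close>.
\<close>

section \<open>Moments of linear combinations of independent variables\<close>

text \<open>Since \<open>m\<close> is an arbitrary real exponent, the \<open>m\<close>-th moment of
  a sum cannot be expanded into monomials. Summands are instead added one at a time, using a
  pointwise inequality whose first-order term is exact: independence and mean zero annihilate it, so
  that only variances and \<open>m\<close>-th moments accumulate and one constant serves every
  number of summands. In the variance the two parts of the residual differ in size: the squared norm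
  of \<open>d\<close> is dominated by a variable whose mean is of order
  \<open>n powr (- 2 * \<alpha>\<sigma>)\<close>, while that of \<open>\<theta>'\<close> is only of
  order \<open>n powr (- \<alpha>\<sigma>)\<close>. But \<open>\<theta>'\<close> is deterministic,
  so its product with the errors is a sum of independent terms and averages out; \<open>d\<close>
  depends on the errors, so its product with them is bounded pointwise. Probabilities are bounded by
  inclusion in measurable exceptional sets, which avoids any measurability argument for the
  estimators.\<close>

lemma powr_one_plus_quadratic_bound:
  fixes m t :: real
  assumes m: "m \<ge> 2" and t: "\<bar>t\<bar> \<le> 1/2"
  shows "(1 + t) powr m \<le> 1 + m * t + (m * (m - 1) * 2 powr (m - 2)) * t\<^sup>2"
proof (cases "t = 0")
  case False
  \<comment> \<open>Taylor's formula at 1 on \<open>[1/2, 3/2]\<close> with Lagrange remainder; it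
    asks for a point other than 1, which is why \<open>t = 0\<close> is separate. The intermediate
    point is below 2 and the exponent \<open>m - 2\<close> is nonnegative, whence
    \<open>2 powr (m - 2)\<close>.\<close>
  define d :: "nat \<Rightarrow> real \<Rightarrow> real" where "d = (\<lambda>k x. if k = 0 then x powr m
     else if k = 1 then m * x powr (m - 1) else m * ((m - 1) * x powr (m - 2)))"
  have "\<exists>s. (if 1 + t < 1 then 1 + t < s \<and> s < 1 else 1 < s \<and> s < 1 + t) \<and>
      (1 + t) powr m = (\<Sum>k<2. d k 1 / fact k * (1 + t - 1) ^ k) + d 2 s / fact 2 * (1 + t - 1)\<^sup>2"
  proof (rule Taylor[of 2 d "\<lambda>x. x powr m" "1/2" "3/2"])
    show "\<forall>k x. k < 2 \<and> 1 / 2 \<le> x \<and> x \<le> 3 / 2 \<longrightarrow> (d k has_real_derivative d (Suc k) x) (at x)"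
    proof (intro allI impI)
      fix k :: nat and x :: real
      assume "k < 2 \<and> 1 / 2 \<le> x \<and> x \<le> 3 / 2"
      then have "k = 0 \<or> k = 1" "x > 0" by auto
      then show "(d k has_real_derivative d (Suc k) x) (at x)"
        unfolding d_def by (auto intro!: derivative_eq_intros simp: algebra_simps)
    qed
  qed (use t False in \<open>auto simp: d_def abs_if split: if_splits\<close>)
  then obtain s where "if 1 + t < 1 then 1 + t < s \<and> s < 1 else 1 < s \<and> s < 1 + t"
    and "(1 + t) powr m = (\<Sum>k<2. d k 1 / fact k * (1 + t - 1) ^ k) + d 2 s / fact 2 * (1 + t - 1)\<^sup>2"
    by blast
  then have s: "0 < s" "s \<le> 2"
    and eq: "(1 + t) powr m = 1 + m * t + (m * ((m - 1) * s powr (m - 2))) / 2 * t\<^sup>2"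
    using t by (auto simp: d_def numeral_2_eq_2 abs_le_iff simp del: One_nat_def split: if_splits)
  have "s powr (m - 2) \<le> 2 powr (m - 2)"
    using s m by (intro powr_mono2) auto
  then have "s powr (m - 2) / 2 \<le> 2 powr (m - 2)"
    using powr_ge_zero[of 2 "m - 2"] by linarith
  then have "m * (m - 1) * (s powr (m - 2) / 2) \<le> m * (m - 1) * 2 powr (m - 2)"
    using m by (intro mult_left_mono) auto
  then have "m * ((m - 1) * s powr (m - 2)) / 2 \<le> m * (m - 1) * 2 powr (m - 2)"
    by (simp add: mult.assoc)
  then have "m * ((m - 1) * s powr (m - 2)) / 2 * t\<^sup>2 \<le> m * (m - 1) * 2 powr (m - 2) * t\<^sup>2"
    by (rule mult_right_mono) simp
  then show ?thesis using eq by linarith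
qed simp

text \<open>The coefficient of \<open>y\<close> is the derivative of
  \<open>\<bar>x\<bar> powr m\<close>. If \<open>x\<close> dominates, factoring out
  \<open>\<bar>x\<bar>\<close> leaves the Taylor bound at \<open>t = y / x\<close>; otherwise every
  term is at most a multiple of \<open>\<bar>y\<bar> powr m\<close>. The linear term carries no
  absolute value because its expectation will vanish.\<close>

lemma abs_powr_add_bound:
  fixes m :: real
  assumes m: "m \<ge> 2"
  obtains C where "C > 0" "\<And>x y. \<bar>x + y\<bar> powr m
    \<le> \<bar>x\<bar> powr m + m * (sgn x * \<bar>x\<bar> powr (m - 1)) * y + C * (\<bar>x\<bar> powr (m - 2) * y\<^sup>2 + \<bar>y\<bar> powr m)"
proof
  define C1 where "C1 = m * (m - 1) * 2 powr (m - 2)"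
  \<comment> \<open>\<open>C1\<close> serves the case of dominant \<open>x\<close>. In the other
    case \<open>\<bar>x + y\<bar> \<le> 3 * \<bar>y\<bar>\<close> costs \<open>3 powr m\<close>, and
    a negative linear term has to be paid back with \<open>m * 2 powr (m - 1)\<close>.\<close>
  define C where "C = C1 + 3 powr m + m * 2 powr (m - 1)"
  have C1: "C1 \<ge> 0" using m by (simp add: C1_def)
  show "C > 0" unfolding C_def using C1 m by (intro add_nonneg_pos) auto
  fix x y :: real
  show "\<bar>x + y\<bar> powr m
    \<le> \<bar>x\<bar> powr m + m * (sgn x * \<bar>x\<bar> powr (m - 1)) * y + C * (\<bar>x\<bar> powr (m - 2) * y\<^sup>2 + \<bar>y\<bar> powr m)"
  proof (cases "\<bar>x\<bar> \<le> 2 * \<bar>y\<bar>")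
    case True
    have a: "\<bar>x + y\<bar> powr m \<le> 3 powr m * \<bar>y\<bar> powr m"
      using True m by (subst powr_mult[symmetric]) (auto intro!: powr_mono2)
    have "\<bar>x\<bar> powr (m - 1) \<le> (2 * \<bar>y\<bar>) powr (m - 1)"
      using True m by (intro powr_mono2) auto
    then have "\<bar>x\<bar> powr (m - 1) * \<bar>y\<bar> \<le> 2 powr (m - 1) * (\<bar>y\<bar> powr (m - 1) * \<bar>y\<bar>)"
      by (subst mult.assoc[symmetric]) (auto simp: powr_mult intro!: mult_right_mono)
    also have "\<bar>y\<bar> powr (m - 1) * \<bar>y\<bar> = \<bar>y\<bar> powr m"
      using m by (cases "y = 0") (auto simp: powr_diff)
    finally have b: "m * (\<bar>x\<bar> powr (m - 1) * \<bar>y\<bar>) \<le> m * 2 powr (m - 1) * \<bar>y\<bar> powr m"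
      using m by (simp add: mult.assoc)
    have "\<bar>m * (sgn x * \<bar>x\<bar> powr (m - 1)) * y\<bar> \<le> m * (\<bar>x\<bar> powr (m - 1) * \<bar>y\<bar>)"
      using m by (cases "x = 0") (auto simp: abs_mult)
    then have c: "- (m * (sgn x * \<bar>x\<bar> powr (m - 1)) * y) \<le> m * 2 powr (m - 1) * \<bar>y\<bar> powr m"
      using b by linarith
    have d: "C * (\<bar>x\<bar> powr (m - 2) * y\<^sup>2 + \<bar>y\<bar> powr m) \<ge> C * \<bar>y\<bar> powr m"
      using \<open>C > 0\<close> by (intro mult_left_mono) auto
    have "C * \<bar>y\<bar> powr m \<ge> 3 powr m * \<bar>y\<bar> powr m + m * 2 powr (m - 1) * \<bar>y\<bar> powr m"
      using C1 by (simp add: C_def algebra_simps)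
    moreover have "\<bar>x\<bar> powr m \<ge> 0" by simp
    ultimately show ?thesis using a c d by linarith
  next
    case False
    then have x: "x \<noteq> 0" by auto
    define t where "t = y / x"
    have t: "\<bar>t\<bar> \<le> 1/2" and y: "y = t * x" using False x by (auto simp: t_def field_simps)
    have "x + y = x * (1 + t)" by (simp add: y algebra_simps)
    then have "\<bar>x + y\<bar> = \<bar>x\<bar> * \<bar>1 + t\<bar>" by (simp only: abs_mult)
    moreover have "\<bar>1 + t\<bar> = 1 + t" using t by (simp add: abs_le_iff)
    ultimately have "\<bar>x + y\<bar> = \<bar>x\<bar> * (1 + t)" by simp
    then have "\<bar>x + y\<bar> powr m = \<bar>x\<bar> powr m * (1 + t) powr m"
      using t by (simp add: powr_mult abs_le_iff)
    also have "\<dots> \<le> \<bar>x\<bar> powr m * (1 + m * t + C1 * t\<^sup>2)"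
      unfolding C1_def by (intro mult_left_mono powr_one_plus_quadratic_bound m t) auto
    also have "\<dots> = \<bar>x\<bar> powr m + m * (sgn x * (\<bar>x\<bar> powr m / \<bar>x\<bar>)) * y + C1 * (\<bar>x\<bar> powr m / \<bar>x\<bar>\<^sup>2) * y\<^sup>2"
      using x unfolding y by (simp add: field_simps sgn_if power2_eq_square)
    also have "\<bar>x\<bar> powr m / \<bar>x\<bar> = \<bar>x\<bar> powr (m - 1)" using x by (simp add: powr_diff)
    also have "\<bar>x\<bar> powr m / \<bar>x\<bar>\<^sup>2 = \<bar>x\<bar> powr (m - 2)" using x by (simp add: powr_diff)
    also have "C1 * \<bar>x\<bar> powr (m - 2) * y\<^sup>2 \<le> C * (\<bar>x\<bar> powr (m - 2) * y\<^sup>2 + \<bar>y\<bar> powr m)"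
      using m C1 by (auto simp: C_def mult.assoc intro!: mult_mono add_increasing2)
    finally show ?thesis by simp
  qed
qed

text \<open>Write the right side as \<open>(A + x) * (A + x) powr (h - 1)\<close> and bound the last
  factor below by \<open>A powr (h - 1)\<close> and by \<open>x powr (h - 1)\<close>, averaging the
  two for the summand \<open>x\<close>. With \<open>A\<close> the squared coefficients collected so
  far, this is the room that absorbs the increment of the moment.\<close>

lemma powr_add_ge_half:
  fixes A x h :: real
  assumes "A > 0" "x \<ge> 0" "h \<ge> 1"
  shows "A powr h + (x * A powr (h - 1) + x powr h) / 2 \<le> (A + x) powr h"
proof -
  have eq: "z powr h = z * z powr (h - 1)" if "z \<ge> 0" for z :: real
    using that assms(3) by (cases "z = 0") (auto simp: powr_diff)
  have 1: "A powr (h - 1) \<le> (A + x) powr (h - 1)" "x powr (h - 1) \<le> (A + x) powr (h - 1)"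
    using assms by (auto intro!: powr_mono2)
  have "A * A powr (h - 1) + (x * A powr (h - 1) + x * x powr (h - 1)) / 2
    \<le> A * (A + x) powr (h - 1) + (x * (A + x) powr (h - 1) + x * (A + x) powr (h - 1)) / 2"
    using assms 1 by (intro add_mono divide_right_mono mult_left_mono) auto
  then show ?thesis using assms by (simp add: eq algebra_simps)
qed

text \<open>Split at \<open>t\<^sup>2 = L\<close>. The free level \<open>L\<close> acts like the
  weight in Young's inequality: a large \<open>L\<close> makes the share of the \<open>m\<close>-th
  moment small enough to be absorbed in the induction.\<close>

lemma powr_interpolation:
  fixes t L m :: real
  assumes "t \<ge> 0" "L > 0" "m \<ge> 2"
  shows "t powr (m - 2) \<le> L powr (m / 2 - 1) + t powr m / L"
proof (cases "t\<^sup>2 \<le> L")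
  case True
  have "t powr (m - 2) = (t\<^sup>2) powr (m / 2 - 1)"
    using assms by (cases "t = 0") (auto simp: powr_powr algebra_simps simp flip: powr_numeral)
  also have "\<dots> \<le> L powr (m / 2 - 1)" using assms True by (intro powr_mono2) auto
  finally show ?thesis using assms by (simp add: add_increasing2)
next
  case False
  then have t: "t > 0" using assms by (cases "t = 0") auto
  have "t powr (m - 2) = t powr m / t\<^sup>2" using t by (simp add: powr_diff)
  also have "\<dots> \<le> t powr m / L" using False assms t by (intro divide_left_mono) auto
  finally show ?thesis using assms by (simp add: add_increasing)
qed

lemma powr_le_one_plus_powr:
  fixes x :: real
  assumes "0 \<le> a" "a \<le> m"
  shows "\<bar>x\<bar> powr a \<le> 1 + \<bar>x\<bar> powr m"
proof (cases "\<bar>x\<bar> \<le> 1")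
  case True
  then have "\<bar>x\<bar> powr a \<le> 1" using assms by (intro powr_le1) auto
  then show ?thesis by (simp add: add_increasing2)
next
  case False
  then have "\<bar>x\<bar> powr a \<le> \<bar>x\<bar> powr m" using assms by (intro powr_mono) auto
  then show ?thesis by simp
qed

lemma power2_powr_half: "(x\<^sup>2) powr (m / 2) = \<bar>x\<bar> powr m" for x m :: real
proof -
  have "(\<bar>x\<bar> powr 2) powr (m / 2) = \<bar>x\<bar> powr m" by (subst powr_powr) simp
  then show ?thesis by (cases "x = 0") auto
qed

section \<open>Integrability and the induction over the summands\<close>

context prob_space
begin

lemma integrable_powr_le:
  fixes f :: "'a \<Rightarrow> real"
  assumes [measurable]: "f \<in> borel_measurable M"
    and "integrable M (\<lambda>\<omega>. \<bar>f \<omega>\<bar> powr m)" "0 \<le> a" "a \<le> m"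
  shows "integrable M (\<lambda>\<omega>. \<bar>f \<omega>\<bar> powr a)"
  by (rule Bochner_Integration.integrable_bound[where f = "\<lambda>\<omega>. 1 + \<bar>f \<omega>\<bar> powr m"])
     (use assms powr_le_one_plus_powr in \<open>auto\<close>)

lemma integrable_power2_of_powr:
  fixes f :: "'a \<Rightarrow> real"
  assumes "f \<in> borel_measurable M" "integrable M (\<lambda>\<omega>. \<bar>f \<omega>\<bar> powr m)" "2 \<le> m"
  shows "integrable M (\<lambda>\<omega>. (f \<omega>)\<^sup>2)"
proof -
  have "(\<lambda>\<omega>. \<bar>f \<omega>\<bar> powr 2) = (\<lambda>\<omega>. (f \<omega>)\<^sup>2)"
    by (intro ext) (metis abs_ge_zero power2_abs powr_numeral)
  then show ?thesis
    using integrable_powr_le[OF assms(1,2), of 2] assms(3) by simp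
qed

text \<open>The linear term has mean zero since \<open>Y\<close> is centred and independent of
  functions of \<open>S\<close>; the quadratic term factorizes. Taking \<open>C\<close> with its
  inequality as a hypothesis keeps the same constant at every step of the later induction.\<close>

lemma integral_powr_add_le:
  fixes m :: real and S Y :: "'a \<Rightarrow> real"
  assumes m: "m \<ge> 2" and C: "C > 0" "\<And>x y. \<bar>x + y\<bar> powr m
    \<le> \<bar>x\<bar> powr m + m * (sgn x * \<bar>x\<bar> powr (m - 1)) * y + C * (\<bar>x\<bar> powr (m - 2) * y\<^sup>2 + \<bar>y\<bar> powr m)"
    and ind: "indep_var borel Y borel S"
    and S: "integrable M (\<lambda>\<omega>. \<bar>S \<omega>\<bar> powr m)"
    and Y: "integrable M (\<lambda>\<omega>. \<bar>Y \<omega>\<bar> powr m)" "integrable M Y" "expectation Y = 0"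
  shows "integrable M (\<lambda>\<omega>. \<bar>S \<omega> + Y \<omega>\<bar> powr m)"
    and "expectation (\<lambda>\<omega>. \<bar>S \<omega> + Y \<omega>\<bar> powr m) \<le> expectation (\<lambda>\<omega>. \<bar>S \<omega>\<bar> powr m)
      + C * (expectation (\<lambda>\<omega>. \<bar>S \<omega>\<bar> powr (m - 2)) * expectation (\<lambda>\<omega>. (Y \<omega>)\<^sup>2)
             + expectation (\<lambda>\<omega>. \<bar>Y \<omega>\<bar> powr m))"
proof -
  have [measurable]: "S \<in> borel_measurable M" "Y \<in> borel_measurable M"
    using indep_var_rv1[OF ind] indep_var_rv2[OF ind] by auto
  have iS: "integrable M (\<lambda>\<omega>. \<bar>S \<omega>\<bar> powr (m - 2))" "integrable M (\<lambda>\<omega>. \<bar>S \<omega>\<bar> powr (m - 1))"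
    using m by (auto intro!: integrable_powr_le[OF _ S])
  have iS': "integrable M (\<lambda>\<omega>. sgn (S \<omega>) * \<bar>S \<omega>\<bar> powr (m - 1))"
    by (rule Bochner_Integration.integrable_bound[OF iS(2)]) (auto simp: abs_mult sgn_if)
  have iY: "integrable M (\<lambda>\<omega>. (Y \<omega>)\<^sup>2)"
    by (rule integrable_power2_of_powr[OF _ Y(1) m]) auto
  have ind1: "indep_var borel (\<lambda>\<omega>. (Y \<omega>)\<^sup>2) borel (\<lambda>\<omega>. \<bar>S \<omega>\<bar> powr (m - 2))"
    using indep_var_compose[OF ind, of "\<lambda>x. x\<^sup>2" borel "\<lambda>x. \<bar>x\<bar> powr (m - 2)" borel] by (simp add: comp_def)
  have ind2: "indep_var borel Y borel (\<lambda>\<omega>. sgn (S \<omega>) * \<bar>S \<omega>\<bar> powr (m - 1))"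
    using indep_var_compose[OF ind, of "\<lambda>x. x" borel "\<lambda>x. sgn x * \<bar>x\<bar> powr (m - 1)" borel]
    by (simp add: comp_def)
  note E1 = indep_var_lebesgue_integral[OF ind1 iY iS(1)] indep_var_integrable[OF ind1 iY iS(1)]
  note E2 = indep_var_lebesgue_integral[OF ind2 Y(2) iS'] indep_var_integrable[OF ind2 Y(2) iS']
  define R where "R \<omega> = \<bar>S \<omega>\<bar> powr m + (m * (Y \<omega> * (sgn (S \<omega>) * \<bar>S \<omega>\<bar> powr (m - 1)))
      + C * ((Y \<omega>)\<^sup>2 * \<bar>S \<omega>\<bar> powr (m - 2) + \<bar>Y \<omega>\<bar> powr m))" for \<omega>
  have R: "\<bar>S \<omega> + Y \<omega>\<bar> powr m \<le> R \<omega>" for \<omega>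
    using C(2)[of "S \<omega>" "Y \<omega>"] by (simp add: R_def mult_ac)
  have iR: "integrable M R" unfolding R_def using S E1 E2 Y by auto
  show int: "integrable M (\<lambda>\<omega>. \<bar>S \<omega> + Y \<omega>\<bar> powr m)"
    by (rule Bochner_Integration.integrable_bound[OF iR]) (use R in \<open>auto intro!: order_trans[OF R abs_ge_self]\<close>)
  have "expectation (\<lambda>\<omega>. \<bar>S \<omega> + Y \<omega>\<bar> powr m) \<le> expectation R"
    by (rule integral_mono[OF int iR]) (rule R)
  also have "expectation R = expectation (\<lambda>\<omega>. \<bar>S \<omega>\<bar> powr m)
      + C * (expectation (\<lambda>\<omega>. \<bar>S \<omega>\<bar> powr (m - 2)) * expectation (\<lambda>\<omega>. (Y \<omega>)\<^sup>2)
             + expectation (\<lambda>\<omega>. \<bar>Y \<omega>\<bar> powr m))"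
    unfolding R_def using S E1 E2 Y by (simp add: mult.commute)
  finally show "expectation (\<lambda>\<omega>. \<bar>S \<omega> + Y \<omega>\<bar> powr m) \<le> expectation (\<lambda>\<omega>. \<bar>S \<omega>\<bar> powr m)
      + C * (expectation (\<lambda>\<omega>. \<bar>S \<omega>\<bar> powr (m - 2)) * expectation (\<lambda>\<omega>. (Y \<omega>)\<^sup>2)
             + expectation (\<lambda>\<omega>. \<bar>Y \<omega>\<bar> powr m))" .
qed

text \<open>A form of the Marcinkiewicz--Zygmund inequality; the exponent \<open>m\<close> need not be an integer.\<close>

lemma moment_linear_combination:
  fixes \<xi> :: "nat \<Rightarrow> 'a \<Rightarrow> real" and m \<mu> :: real
  assumes m: "m \<ge> 2"
    and ind: "indep_vars (\<lambda>_. borel) \<xi> UNIV"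
    and int: "\<And>i. integrable M (\<xi> i)" "\<And>i. expectation (\<xi> i) = 0"
    and mom: "\<And>i. integrable M (\<lambda>\<omega>. \<bar>\<xi> i \<omega>\<bar> powr m)"
      "\<And>i. expectation (\<lambda>\<omega>. \<bar>\<xi> i \<omega>\<bar> powr m) \<le> \<mu>"
  obtains K where "K > 0" "\<And>a n. integrable M (\<lambda>\<omega>. \<bar>\<Sum>l<n. a l * \<xi> l \<omega>\<bar> powr m)"
    "\<And>a n V. V > 0 \<Longrightarrow> (\<Sum>l<n. (a l)\<^sup>2) \<le> V \<Longrightarrow>
      expectation (\<lambda>\<omega>. \<bar>\<Sum>l<n. a l * \<xi> l \<omega>\<bar> powr m) \<le> K * V powr (m / 2)"
proof -
  obtain C where C: "C > 0" "\<And>x y. \<bar>x + y\<bar> powr m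
    \<le> \<bar>x\<bar> powr m + m * (sgn x * \<bar>x\<bar> powr (m - 1)) * y + C * (\<bar>x\<bar> powr (m - 2) * y\<^sup>2 + \<bar>y\<bar> powr m)"
    using abs_powr_add_bound[OF m] by metis
  have rv: "\<xi> i \<in> borel_measurable M" for i using int(1)[of i] by auto
  have sq: "expectation (\<lambda>\<omega>. (\<xi> i \<omega>)\<^sup>2) \<le> 1 + \<mu>" for i
  proof -
    have "expectation (\<lambda>\<omega>. (\<xi> i \<omega>)\<^sup>2) \<le> expectation (\<lambda>\<omega>. 1 + \<bar>\<xi> i \<omega>\<bar> powr m)"
    proof (rule integral_mono)
      show "(\<xi> i \<omega>)\<^sup>2 \<le> 1 + \<bar>\<xi> i \<omega>\<bar> powr m" for \<omega>
        using powr_le_one_plus_powr[of 2 m "\<xi> i \<omega>"] m by (cases "\<xi> i \<omega> = 0") auto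
    qed (use mom integrable_power2_of_powr[OF rv mom(1) m] in auto)
    then show ?thesis using mom(1)[of i] mom(2)[of i] by (simp add: prob_space)
  qed
  have \<mu>0: "\<mu> \<ge> 0" by (rule order_trans[OF integral_nonneg_AE mom(2)[of 0]]) simp
  \<comment> \<open>\<open>s\<close> bounds the second moments. \<open>\<Lambda>\<close> is so large
    that the \<open>m\<close>-th moment returned by the interpolation has weight at most
    \<open>K / 4\<close>; \<open>K\<close> makes the rest of the quadratic term at most
    \<open>K / 4\<close> and the contribution of the new summand at most \<open>K / 2\<close>. These
    are the halves in \<open>powr_add_ge_half\<close>.\<close>
  define s where "s = 1 + \<mu>"
  define \<Lambda> where "\<Lambda> = 4 * C * s + 1"
  define K where "K = 1 + 4 * C * s * \<Lambda> powr (m / 2 - 1) + 2 * C * \<mu>"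
  have s: "s > 0" using \<mu>0 by (simp add: s_def)
  have \<Lambda>: "\<Lambda> > 0" "C * s / \<Lambda> \<le> 1 / 4" using C s by (auto simp: \<Lambda>_def field_simps add_pos_nonneg)
  have K: "K > 0" "4 * (C * s * \<Lambda> powr (m / 2 - 1)) \<le> K" "2 * C * \<mu> \<le> K"
    using C s \<mu>0 by (auto simp: K_def mult_ac intro!: add_pos_nonneg)
  \<comment> \<open>The slack \<open>v\<close> keeps the base \<open>A\<close> positive, so that
    division by \<open>\<Lambda> * A\<close> and the exponent \<open>m / 2 - 1\<close> are harmless
    even if the first coefficients vanish. Setting \<open>v = V\<close> at the end costs the factor
    \<open>2 powr (m / 2)\<close>.\<close>
  have main: "integrable M (\<lambda>\<omega>. \<bar>\<Sum>l<n. a l * \<xi> l \<omega>\<bar> powr m) \<and>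
     (\<forall>v>0. expectation (\<lambda>\<omega>. \<bar>\<Sum>l<n. a l * \<xi> l \<omega>\<bar> powr m) \<le> K * (v + (\<Sum>l<n. (a l)\<^sup>2)) powr (m / 2))"
    for a :: "nat \<Rightarrow> real" and n
  proof (induction n)
    case 0
    then show ?case using K m by auto
  next
    case (Suc n)
    define S where "S \<omega> = (\<Sum>l<n. a l * \<xi> l \<omega>)" for \<omega>
    define Y where "Y \<omega> = a n * \<xi> n \<omega>" for \<omega>
    define u where "u = expectation (\<lambda>\<omega>. \<bar>S \<omega>\<bar> powr m)"
    have "indep_vars (\<lambda>_. borel) (\<lambda>i \<omega>. a i * \<xi> i \<omega>) (insert n {..<n})"
      by (rule indep_vars_subset[OF indep_vars_compose2[OF ind]]) auto
    from indep_vars_sum[OF _ _ this] have ind: "indep_var borel Y borel S"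
      by (simp add: Y_def[abs_def] S_def[abs_def])
    have iS: "integrable M (\<lambda>\<omega>. \<bar>S \<omega>\<bar> powr m)" using Suc.IH by (simp add: S_def)
    have Ym: "\<bar>Y \<omega>\<bar> powr m = ((a n)\<^sup>2) powr (m / 2) * \<bar>\<xi> n \<omega>\<bar> powr m" for \<omega>
      by (simp add: Y_def abs_mult powr_mult power2_powr_half)
    have Y: "integrable M (\<lambda>\<omega>. \<bar>Y \<omega>\<bar> powr m)" "integrable M Y" "expectation Y = 0"
      unfolding Ym using mom int by (auto simp: Y_def[abs_def])
    have Ym_le: "expectation (\<lambda>\<omega>. \<bar>Y \<omega>\<bar> powr m) \<le> ((a n)\<^sup>2) powr (m / 2) * \<mu>"
      unfolding Ym using mom by (auto intro!: mult_left_mono)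
    have Y2: "expectation (\<lambda>\<omega>. (Y \<omega>)\<^sup>2) \<le> (a n)\<^sup>2 * s"
      unfolding Y_def power_mult_distrib s_def using sq[of n] by (auto intro!: mult_left_mono)
    note step = integral_powr_add_le[OF m C ind iS Y]
    have "expectation (\<lambda>\<omega>. \<bar>S \<omega> + Y \<omega>\<bar> powr m) \<le> K * (v + (\<Sum>l<Suc n. (a l)\<^sup>2)) powr (m / 2)"
      if v: "v > 0" for v
    proof -
      define A where "A = v + (\<Sum>l<n. (a l)\<^sup>2)"
      define B where "B = A powr (m / 2 - 1)"
      define x where "x = (a n)\<^sup>2"
      have A: "A > 0" using v by (auto simp: A_def intro!: add_pos_nonneg sum_nonneg)
      have x: "x \<ge> 0" by (simp add: x_def)
      have u: "u \<le> K * A powr (m / 2)" using Suc.IH v by (auto simp: u_def S_def A_def)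
      have AB: "A powr (m / 2) = A * B" using A by (simp add: B_def powr_diff)
      \<comment> \<open>The level \<open>\<Lambda> * A\<close> scales with the sum of squares, which
        gives both parts of the interpolation the common factor \<open>B\<close>.\<close>
      have "expectation (\<lambda>\<omega>. \<bar>S \<omega>\<bar> powr (m - 2))
          \<le> expectation (\<lambda>\<omega>. (\<Lambda> * A) powr (m / 2 - 1) + \<bar>S \<omega>\<bar> powr m / (\<Lambda> * A))"
      proof (rule integral_mono)
        have "S \<in> borel_measurable M" using indep_var_rv2[OF ind] .
        then show "integrable M (\<lambda>\<omega>. \<bar>S \<omega>\<bar> powr (m - 2))"
          using m by (auto intro!: integrable_powr_le[OF _ iS])
      qed (use iS powr_interpolation[OF _ _ m, of _ "\<Lambda> * A"] A \<Lambda> in auto)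
      also have "\<dots> = (\<Lambda> * A) powr (m / 2 - 1) + u / (\<Lambda> * A)"
        using iS by (simp add: u_def prob_space)
      also have "\<dots> \<le> (\<Lambda> * A) powr (m / 2 - 1) + K * A powr (m / 2) / (\<Lambda> * A)"
        using A \<Lambda> u by (intro add_left_mono divide_right_mono) auto
      also have "\<dots> = (\<Lambda> powr (m / 2 - 1) + K / \<Lambda>) * B"
        using A \<Lambda> unfolding AB by (simp add: powr_mult B_def field_simps)
      finally have Sm2: "expectation (\<lambda>\<omega>. \<bar>S \<omega>\<bar> powr (m - 2)) \<le> (\<Lambda> powr (m / 2 - 1) + K / \<Lambda>) * B" .
      have B: "B \<ge> 0" by (simp add: B_def)
      have "expectation (\<lambda>\<omega>. \<bar>S \<omega>\<bar> powr (m - 2)) * expectation (\<lambda>\<omega>. (Y \<omega>)\<^sup>2)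
          \<le> (\<Lambda> powr (m / 2 - 1) + K / \<Lambda>) * B * (x * s)"
        using Sm2 Y2 \<Lambda> K B x s unfolding x_def by (intro mult_mono) auto
      then have "C * (expectation (\<lambda>\<omega>. \<bar>S \<omega>\<bar> powr (m - 2)) * expectation (\<lambda>\<omega>. (Y \<omega>)\<^sup>2)
             + expectation (\<lambda>\<omega>. \<bar>Y \<omega>\<bar> powr m))
          \<le> C * ((\<Lambda> powr (m / 2 - 1) + K / \<Lambda>) * B * (x * s) + x powr (m / 2) * \<mu>)"
        using Ym_le C(1) unfolding x_def by (intro mult_left_mono add_mono) auto
      also have "\<dots> = (C * s * \<Lambda> powr (m / 2 - 1) + K * (C * s / \<Lambda>)) * (x * B) + C * \<mu> * x powr (m / 2)"
        by (simp add: algebra_simps)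
      also have "\<dots> \<le> (K / 4 + K * (1 / 4)) * (x * B) + K / 2 * x powr (m / 2)"
        using K \<Lambda> x B by (intro add_mono mult_right_mono mult_left_mono) auto
      also have "\<dots> = K * ((x * B + x powr (m / 2)) / 2)" by (simp add: algebra_simps)
      finally have "expectation (\<lambda>\<omega>. \<bar>S \<omega> + Y \<omega>\<bar> powr m)
          \<le> K * (A powr (m / 2) + (x * B + x powr (m / 2)) / 2)"
        using step(2) u unfolding u_def distrib_left[of K "A powr _"] by linarith
      also have "\<dots> \<le> K * (A + x) powr (m / 2)"
        using powr_add_ge_half[of A x "m / 2"] A x m K by (intro mult_left_mono) (auto simp: B_def)
      finally show ?thesis by (simp add: A_def x_def add.assoc)
    qed
    then show ?case using step(1) by (simp add: S_def Y_def)
  qed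
  show thesis
  proof (rule that[of "K * 2 powr (m / 2)"])
    fix a :: "nat \<Rightarrow> real" and n V
    show "integrable M (\<lambda>\<omega>. \<bar>\<Sum>l<n. a l * \<xi> l \<omega>\<bar> powr m)" using main by blast
    assume V: "V > 0" "(\<Sum>l<n. (a l)\<^sup>2) \<le> V"
    have "expectation (\<lambda>\<omega>. \<bar>\<Sum>l<n. a l * \<xi> l \<omega>\<bar> powr m) \<le> K * (V + (\<Sum>l<n. (a l)\<^sup>2)) powr (m / 2)"
      using main V by blast
    also have "\<dots> \<le> K * (2 * V) powr (m / 2)"
      using V K m by (intro mult_left_mono powr_mono2) (auto intro!: add_nonneg_nonneg sum_nonneg)
    finally show "expectation (\<lambda>\<omega>. \<bar>\<Sum>l<n. a l * \<xi> l \<omega>\<bar> powr m) \<le> K * 2 powr (m / 2) * V powr (m / 2)"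
      using V by (simp add: powr_mult)
  qed (use K in auto)
qed

end

section \<open>The ridge estimator in singular value coordinates\<close>

lemma sum_power2_orthonormal_combination:
  fixes U :: "nat \<Rightarrow> nat \<Rightarrow> real"
  assumes orth: "\<And>k k'. k < r \<Longrightarrow> k' < r \<Longrightarrow> (\<Sum>l<n. U l k * U l k') = (if k = k' then 1 else 0)"
  shows "(\<Sum>l<n. (\<Sum>k<r. v k * U l k)\<^sup>2) = (\<Sum>k<r. (v k)\<^sup>2)"
proof -
  have "(\<Sum>l<n. (\<Sum>k<r. v k * U l k)\<^sup>2)
      = (\<Sum>l<n. \<Sum>k<r. \<Sum>k'<r. v k * v k' * (U l k * U l k'))"
    by (simp add: power2_eq_square sum_product mult_ac)
  also have "\<dots> = (\<Sum>k<r. \<Sum>l<n. \<Sum>k'<r. v k * v k' * (U l k * U l k'))"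
    by (rule sum.swap)
  also have "\<dots> = (\<Sum>k<r. \<Sum>k'<r. \<Sum>l<n. v k * v k' * (U l k * U l k'))"
    by (intro sum.cong refl sum.swap)
  also have "\<dots> = (\<Sum>k<r. \<Sum>k'<r. v k * v k' * (if k = k' then 1 else 0))"
    by (intro sum.cong refl) (auto simp: sum_distrib_left[symmetric] orth)
  also have "\<dots> = (\<Sum>k<r. (v k)\<^sup>2)"
    by (simp add: power2_eq_square if_distrib cong: if_cong)
  finally show ?thesis .
qed

text \<open>The squared distance from \<open>v\<close> to its projection on the columns of
  \<open>U\<close> is nonnegative. This handles vectors outside the span of the columns.\<close>

lemma Bessel_inequality_sum:
  fixes U :: "nat \<Rightarrow> nat \<Rightarrow> real"
  assumes orth: "\<And>k k'. k < r \<Longrightarrow> k' < r \<Longrightarrow> (\<Sum>l<n. U l k * U l k') = (if k = k' then 1 else 0)"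
  shows "(\<Sum>k<r. (\<Sum>l<n. U l k * v l)\<^sup>2) \<le> (\<Sum>l<n. (v l)\<^sup>2)"
proof -
  define c where "c k = (\<Sum>l<n. U l k * v l)" for k
  have "(\<Sum>l<n. v l * (\<Sum>k<r. c k * U l k)) = (\<Sum>l<n. \<Sum>k<r. c k * (U l k * v l))"
    by (simp add: sum_distrib_left mult_ac)
  also have "\<dots> = (\<Sum>k<r. \<Sum>l<n. c k * (U l k * v l))" by (rule sum.swap)
  also have "\<dots> = (\<Sum>k<r. (c k)\<^sup>2)"
    by (simp add: c_def sum_distrib_left power2_eq_square)
  finally have cross: "(\<Sum>l<n. v l * (\<Sum>k<r. c k * U l k)) = (\<Sum>k<r. (c k)\<^sup>2)" .
  have "0 \<le> (\<Sum>l<n. (v l - (\<Sum>k<r. c k * U l k))\<^sup>2)" by (intro sum_nonneg) auto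
  also have "\<dots> = (\<Sum>l<n. (v l)\<^sup>2) - 2 * (\<Sum>l<n. v l * (\<Sum>k<r. c k * U l k))
      + (\<Sum>l<n. (\<Sum>k<r. c k * U l k)\<^sup>2)"
    by (simp add: power2_diff sum.distrib sum_subtractf sum_distrib_left mult.assoc)
  also have "\<dots> = (\<Sum>l<n. (v l)\<^sup>2) - (\<Sum>k<r. (c k)\<^sup>2)"
    unfolding cross by (subst sum_power2_orthonormal_combination[OF orth]) auto
  finally show ?thesis by (simp add: c_def)
qed

section \<open>Inverses and diagonal matrices\<close>

lemma minv_left_inverse:
  assumes A: "A \<in> carrier_mat n n"
    and inj: "\<And>v. v \<in> carrier_vec n \<Longrightarrow> A *\<^sub>v v = 0\<^sub>v n \<Longrightarrow> v = 0\<^sub>v n"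
  shows "minv A * A = 1\<^sub>m n" and "minv A \<in> carrier_mat n n"
proof -
  \<comment> \<open>\<open>minv\<close> takes \<open>the\<close> of an optional value, so it says
    nothing until a unit of the matrix ring has been exhibited; the trivial kernel yields one
    through the determinant.\<close>
  have "det A \<noteq> 0" using det_0_iff_vec_prod_zero[OF A] inj by blast
  then have "A \<in> Units (ring_mat TYPE(real) n ())" by (rule det_non_zero_imp_unit[OF A])
  then obtain B where "mat_inverse A = Some B"
    using mat_inverse(1)[OF A, where b = "()"] by (cases "mat_inverse A") auto
  then show "minv A * A = 1\<^sub>m n" "minv A \<in> carrier_mat n n"
    using mat_inverse(2)[OF A] by (auto simp: minv_def)
qed

lemma diagm_carrier [simp]: "diagm r f \<in> carrier_mat r r"
  by (simp add: diagm_def)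

lemma diagm_mult_vec:
  assumes "v \<in> carrier_vec r"
  shows "diagm r f *\<^sub>v v = vec r (\<lambda>k. f k * v $ k)"
proof (rule eq_vecI)
  fix k assume "k < dim_vec (vec r (\<lambda>k. f k * v $ k))"
  then have k: "k < r" by simp
  have "(diagm r f *\<^sub>v v) $ k = (\<Sum>i = 0..<r. (if k = i then f k else 0) * v $ i)"
    using k assms by (simp add: diagm_def scalar_prod_def)
  also have "\<dots> = (\<Sum>i = 0..<r. if k = i then f k * v $ i else 0)"
    by (intro sum.cong) auto
  finally show "(diagm r f *\<^sub>v v) $ k = vec r (\<lambda>k. f k * v $ k) $ k" using k by simp
qed (simp add: diagm_def)

lemma diagm_mult: "diagm r f * diagm r g = diagm r (\<lambda>k. f k * g k)"
proof (rule eq_matI)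
  fix i j assume "i < dim_row (diagm r (\<lambda>k. f k * g k))" "j < dim_col (diagm r (\<lambda>k. f k * g k))"
  then have ij: "i < r" "j < r" by (auto simp: diagm_def)
  have "(diagm r f * diagm r g) $$ (i, j)
      = (\<Sum>k = 0..<r. (if i = k then f i else 0) * (if k = j then g k else 0))"
    using ij by (simp add: diagm_def scalar_prod_def)
  also have "\<dots> = (\<Sum>k = 0..<r. if i = k then f i * (if k = j then g k else 0) else 0)"
    by (intro sum.cong) auto
  finally show "(diagm r f * diagm r g) $$ (i, j) = diagm r (\<lambda>k. f k * g k) $$ (i, j)"
    using ij by (simp add: diagm_def)
qed (auto simp: diagm_def)

lemma minv_diagm:
  assumes "\<And>k. k < r \<Longrightarrow> f k \<noteq> 0"
  shows "minv (diagm r f) = diagm r (\<lambda>k. 1 / f k)"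
proof -
  have "v = 0\<^sub>v r" if "v \<in> carrier_vec r" "diagm r f *\<^sub>v v = 0\<^sub>v r" for v
  proof (rule eq_vecI)
    fix k assume k: "k < dim_vec (0\<^sub>v r)"
    then have "f k * v $ k = 0\<^sub>v r $ k" using that by (simp add: diagm_mult_vec flip: that(2))
    then show "v $ k = 0\<^sub>v r $ k" using k assms by simp
  qed (use that in auto)
  then have inv: "minv (diagm r f) * diagm r f = 1\<^sub>m r" "minv (diagm r f) \<in> carrier_mat r r"
    by (auto intro!: minv_left_inverse)
  have one: "diagm r f * diagm r (\<lambda>k. 1 / f k) = 1\<^sub>m r"
    unfolding diagm_mult using assms by (intro eq_matI) (auto simp: diagm_def)
  \<comment> \<open>Only a left inverse is known so far; multiplying it by the explicit right
    inverse identifies it.\<close>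
  have "minv (diagm r f) = minv (diagm r f) * (diagm r f * diagm r (\<lambda>k. 1 / f k))"
    using inv by (simp add: one)
  also have "\<dots> = minv (diagm r f) * diagm r f * diagm r (\<lambda>k. 1 / f k)"
    by (rule assoc_mult_mat[OF inv(2) diagm_carrier diagm_carrier, symmetric])
  finally show ?thesis by (simp add: inv left_mult_one_mat[of _ r r])
qed

lemma mult_mat_vec_index_sum:
  assumes "A \<in> carrier_mat n p" "v \<in> carrier_vec p" "i < n"
  shows "(A *\<^sub>v v) $ i = (\<Sum>j<p. A $$ (i, j) * v $ j)"
  using assms by (auto simp: scalar_prod_def atLeast0LessThan)

lemma orthonormal_columns_sum:
  assumes "A \<in> carrier_mat n r" "transpose_mat A * A = 1\<^sub>m r" "k < r" "k' < r"
  shows "(\<Sum>l<n. A $$ (l, k) * A $$ (l, k')) = (if k = k' then 1 else 0)"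
proof -
  have "(transpose_mat A * A) $$ (k, k') = (\<Sum>l<n. A $$ (l, k) * A $$ (l, k'))"
    using assms(1,3,4) by (auto simp: scalar_prod_def atLeast0LessThan)
  then show ?thesis using assms by simp
qed

text \<open>One sample size is fixed and the errors are an arbitrary function \<open>e\<close>, so
  all facts here are deterministic; the random errors are substituted for \<open>e\<close> only
  later.\<close>

locale ridge_design =
  fixes n p r :: nat and X P Q Qp :: "real mat" and lam :: "nat \<Rightarrow> real" and \<rho> :: real
    and \<beta> :: "real vec"
  assumes X_carrier: "X \<in> carrier_mat n p" and \<beta>_carrier: "\<beta> \<in> carrier_vec p"
    and P_carrier: "P \<in> carrier_mat n r" and Q_carrier: "Q \<in> carrier_mat p r"
    and svd: "X = P * diagm r lam * transpose_mat Q"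
    and P_orth: "transpose_mat P * P = 1\<^sub>m r" and Q_orth: "transpose_mat Q * Q = 1\<^sub>m r"
    and lam_pos: "\<And>k. k < r \<Longrightarrow> lam k > 0"
    and Qp_carrier: "Qp \<in> carrier_mat p (p - r)"
    and perp_sum: "Q * transpose_mat Q + Qp * transpose_mat Qp = 1\<^sub>m p"
    and \<rho>_pos: "\<rho> > 0"
begin

definition zeta :: "real vec" where "zeta = transpose_mat Q *\<^sub>v \<beta>"
definition wgt :: "nat \<Rightarrow> real" where
  "wgt k = lam k / ((lam k)\<^sup>2 + \<rho>) + \<rho> * lam k / ((lam k)\<^sup>2 + \<rho>)\<^sup>2"
text \<open>Equal to \<open>1 - wgt k * lam k\<close>, the fraction of \<open>zeta $ k\<close> that
  the estimator still loses. Plain ridge regression loses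
  \<open>\<rho> / ((lam k)\<^sup>2 + \<rho>)\<close>; the correction squares it.\<close>

definition shrink :: "nat \<Rightarrow> real" where "shrink k = \<rho>\<^sup>2 / ((lam k)\<^sup>2 + \<rho>)\<^sup>2"
definition score :: "(nat \<Rightarrow> real) \<Rightarrow> nat \<Rightarrow> real" where "score e k = (\<Sum>l<n. P $$ (l, k) * e l)"
text \<open>A linear functional of the estimation error is encoded by its coefficients
  \<open>d\<close> against the columns of \<open>Q\<close>. Single coordinates
  (\<open>row j\<close>) and rows of the contrast matrix (\<open>ccoef\<close>) then share one
  decomposition into a deterministic and a random part.\<close>

definition bias :: "(nat \<Rightarrow> real) \<Rightarrow> real" where
  "bias d = (\<Sum>k<r. d k * (- (shrink k * zeta $ k)))"
definition noise_coef :: "(nat \<Rightarrow> real) \<Rightarrow> nat \<Rightarrow> real" where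
  "noise_coef d l = (\<Sum>k<r. d k * wgt k * P $$ (l, k))"

abbreviation "theta \<equiv> proj Q \<beta>"
abbreviation "resp e \<equiv> X *\<^sub>v \<beta> + vec n e"
abbreviation "tt e \<equiv> theta_tilde X Q (diagm r lam) \<rho> (resp e)"

lemmas carriers = X_carrier \<beta>_carrier P_carrier Q_carrier Qp_carrier

lemma product_carriers [simp]:
  "P * diagm r f \<in> carrier_mat n r" "Q * diagm r f \<in> carrier_mat p r"
  "diagm r f * transpose_mat P \<in> carrier_mat r n"
  using P_carrier Q_carrier by (auto intro!: mult_carrier_mat[of _ _ r])

lemma mult_vec_carriers [simp]:
  "P *\<^sub>v v \<in> carrier_vec n" "Q *\<^sub>v v \<in> carrier_vec p" "X *\<^sub>v v \<in> carrier_vec n"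
  "diagm r f *\<^sub>v v \<in> carrier_vec r"
  "transpose_mat P *\<^sub>v v \<in> carrier_vec r" "transpose_mat Q *\<^sub>v v \<in> carrier_vec r"
  using carriers by (auto intro!: carrier_vecI simp: diagm_def)

lemma lam_sq_pos: "(lam k)\<^sup>2 + \<rho> > 0"
  using \<rho>_pos by (intro add_nonneg_pos) auto

lemma zeta_carrier [simp]: "zeta \<in> carrier_vec r"
  using carriers by (simp add: zeta_def)

lemma theta_eq: "theta = Q *\<^sub>v zeta"
  using carriers by (simp add: proj_def zeta_def assoc_mult_mat_vec[of _ p r _ p])

lemma theta_carrier: "theta \<in> carrier_vec p"
  using carriers by (simp add: theta_eq)

lemma theta_index: "j < p \<Longrightarrow> theta $ j = (\<Sum>k<r. Q $$ (j, k) * zeta $ k)"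
  unfolding theta_eq by (rule mult_mat_vec_index_sum) (use carriers in auto)

lemma X_mult_Q:
  assumes "v \<in> carrier_vec r"
  shows "X *\<^sub>v (Q *\<^sub>v v) = P *\<^sub>v (diagm r lam *\<^sub>v v)"
proof -
  have "X *\<^sub>v (Q *\<^sub>v v) = P *\<^sub>v (diagm r lam *\<^sub>v (transpose_mat Q *\<^sub>v (Q *\<^sub>v v)))"
    unfolding svd using carriers assms
    by (simp add: assoc_mult_mat_vec[of _ n r _ p] assoc_mult_mat_vec[of _ n r _ r])
  also have "transpose_mat Q *\<^sub>v (Q *\<^sub>v v) = (transpose_mat Q * Q) *\<^sub>v v"
    using carriers assms by (simp add: assoc_mult_mat_vec[of _ r p _ r])
  finally show ?thesis using assms by (simp add: Q_orth)
qed

lemma X_transpose: "transpose_mat X = Q * (diagm r lam * transpose_mat P)"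
proof -
  have "transpose_mat (diagm r lam) = diagm r lam" by (auto simp: diagm_def)
  then show ?thesis unfolding svd using carriers
    by (simp add: transpose_mult[of _ n r _ p] transpose_mult[of _ n r _ r])
qed

lemma X_transpose_vec:
  assumes "v \<in> carrier_vec n"
  shows "transpose_mat X *\<^sub>v v = Q *\<^sub>v (diagm r lam *\<^sub>v (transpose_mat P *\<^sub>v v))"
  unfolding X_transpose using carriers assms
  by (simp add: assoc_mult_mat_vec[of _ p r _ n] assoc_mult_mat_vec[of _ r r _ n])

text \<open>Instead of diagonalizing the \<open>p\<close> by \<open>p\<close> matrix, which would
  involve the complement of the columns of \<open>Q\<close>, the candidate
  \<open>Q *\<^sub>v u\<close> is checked to solve the normal equations. The solution is unique
  since \<open>v \<bullet> (A *\<^sub>v v)\<close> is the squared norm of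
  \<open>X *\<^sub>v v\<close> plus \<open>\<rho>\<close> times that of \<open>v\<close>.\<close>

lemma ridge_eq:
  assumes y: "y \<in> carrier_vec n"
  shows "ridge X \<rho> y
    = Q *\<^sub>v vec r (\<lambda>k. lam k / ((lam k)\<^sup>2 + \<rho>) * (transpose_mat P *\<^sub>v y) $ k)"
proof -
  define A where "A = transpose_mat X * X + \<rho> \<cdot>\<^sub>m 1\<^sub>m p"
  define z where "z = transpose_mat P *\<^sub>v y"
  define u where "u = vec r (\<lambda>k. lam k / ((lam k)\<^sup>2 + \<rho>) * z $ k)"
  have A: "A \<in> carrier_mat p p" using carriers by (simp add: A_def)
  have z: "z \<in> carrier_vec r" and u: "u \<in> carrier_vec r" using carriers y by (auto simp: z_def u_def)
  have Av: "A *\<^sub>v v = transpose_mat X *\<^sub>v (X *\<^sub>v v) + \<rho> \<cdot>\<^sub>v v" if "v \<in> carrier_vec p" for v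
  proof -
    have "\<rho> \<cdot>\<^sub>m 1\<^sub>m p *\<^sub>v v = \<rho> \<cdot>\<^sub>v v" using that by (auto simp: smult_scalar_prod_distrib[of _ p])
    then show ?thesis unfolding A_def using carriers that
      by (simp add: add_mult_distrib_mat_vec[of _ p p] assoc_mult_mat_vec[of _ p n _ p])
  qed
  have "v = 0\<^sub>v p" if v: "v \<in> carrier_vec p" and "A *\<^sub>v v = 0\<^sub>v p" for v
  proof -
    have "0 = v \<bullet> (A *\<^sub>v v)" using that by simp
    also have "\<dots> = v \<bullet> (transpose_mat X *\<^sub>v (X *\<^sub>v v)) + \<rho> * (v \<bullet> v)"
      unfolding Av[OF v] using v carriers by (simp add: scalar_prod_add_distrib[of _ p])
    also have "v \<bullet> (transpose_mat X *\<^sub>v (X *\<^sub>v v)) = (transpose_mat X *\<^sub>v (X *\<^sub>v v)) \<bullet> v"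
      by (rule comm_scalar_prod[of _ p]) (use v carriers in auto)
    also have "\<dots> = (X *\<^sub>v v) \<bullet> (X *\<^sub>v v)"
      by (rule transpose_vec_mult_scalar[OF X_carrier v]) (use v carriers in auto)
    finally have eq: "(X *\<^sub>v v) \<bullet> (X *\<^sub>v v) + \<rho> * (v \<bullet> v) = 0" by simp
    have nn: "w \<bullet> w \<ge> 0" for w :: "real vec" by (auto simp: scalar_prod_def intro!: sum_nonneg)
    have "\<rho> * (v \<bullet> v) \<le> 0" using eq nn[of "X *\<^sub>v v"] by linarith
    then have "v \<bullet> v = 0" using \<rho>_pos nn[of v] by (simp add: mult_le_0_iff)
    then have "(\<Sum>i = 0..<p. v $ i * v $ i) = 0" using v by (simp add: scalar_prod_def)
    then have "\<forall>i\<in>{0..<p}. v $ i * v $ i = 0" by (subst (asm) sum_nonneg_eq_0_iff) auto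
    then show ?thesis using v by (intro eq_vecI) auto
  qed
  then have inv: "minv A * A = 1\<^sub>m p" "minv A \<in> carrier_mat p p"
    by (auto intro!: minv_left_inverse[OF A])
  have Qu: "Q *\<^sub>v u \<in> carrier_vec p" using carriers u by simp
  have "A *\<^sub>v (Q *\<^sub>v u) = transpose_mat X *\<^sub>v (P *\<^sub>v (diagm r lam *\<^sub>v u)) + \<rho> \<cdot>\<^sub>v (Q *\<^sub>v u)"
    using Av[OF Qu] u by (simp add: X_mult_Q)
  also have "transpose_mat X *\<^sub>v (P *\<^sub>v (diagm r lam *\<^sub>v u))
      = Q *\<^sub>v (diagm r lam *\<^sub>v (transpose_mat P *\<^sub>v (P *\<^sub>v (diagm r lam *\<^sub>v u))))"
    using carriers by (intro X_transpose_vec) (auto simp: diagm_def)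
  also have "transpose_mat P *\<^sub>v (P *\<^sub>v (diagm r lam *\<^sub>v u)) = (transpose_mat P * P) *\<^sub>v (diagm r lam *\<^sub>v u)"
    using carriers u by (intro assoc_mult_mat_vec[symmetric]) auto
  also have "\<dots> = diagm r lam *\<^sub>v u" using u carriers unfolding P_orth
    by (intro one_mult_mat_vec) auto
  also have "\<rho> \<cdot>\<^sub>v (Q *\<^sub>v u) = Q *\<^sub>v (\<rho> \<cdot>\<^sub>v u)" using carriers u by (simp add: mult_mat_vec)
  also have "Q *\<^sub>v (diagm r lam *\<^sub>v (diagm r lam *\<^sub>v u)) + Q *\<^sub>v (\<rho> \<cdot>\<^sub>v u)
      = Q *\<^sub>v (diagm r lam *\<^sub>v (diagm r lam *\<^sub>v u) + \<rho> \<cdot>\<^sub>v u)"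
    using carriers u by (intro mult_add_distrib_mat_vec[symmetric]) auto
  also have "diagm r lam *\<^sub>v (diagm r lam *\<^sub>v u) + \<rho> \<cdot>\<^sub>v u = diagm r lam *\<^sub>v z"
  proof (rule eq_vecI)
    fix k assume "k < dim_vec (diagm r lam *\<^sub>v z)"
    then have k: "k < r" by (simp add: diagm_def)
    have "lam k * (lam k * (lam k / ((lam k)\<^sup>2 + \<rho>) * z $ k)) + \<rho> * (lam k / ((lam k)\<^sup>2 + \<rho>) * z $ k)
        = ((lam k)\<^sup>2 + \<rho>) * (lam k / ((lam k)\<^sup>2 + \<rho>) * z $ k)"
      by (simp only: distrib_right power2_eq_square mult.assoc)
    also have "\<dots> = lam k * z $ k" using lam_sq_pos[of k] by simp
    finally show "(diagm r lam *\<^sub>v (diagm r lam *\<^sub>v u) + \<rho> \<cdot>\<^sub>v u) $ k = (diagm r lam *\<^sub>v z) $ k"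
      using k z u by (simp add: diagm_mult_vec u_def)
  qed (use u in \<open>auto simp: diagm_def\<close>)
  also have "Q *\<^sub>v (diagm r lam *\<^sub>v z) = transpose_mat X *\<^sub>v y"
    using X_transpose_vec[OF y] by (simp add: z_def)
  finally have "minv A *\<^sub>v (transpose_mat X *\<^sub>v y) = minv A *\<^sub>v (A *\<^sub>v (Q *\<^sub>v u))" by simp
  also have "\<dots> = Q *\<^sub>v u"
    using inv A Qu by (simp flip: assoc_mult_mat_vec[of "minv A" p p A p])
  finally show ?thesis using carriers by (simp add: ridge_def A_def u_def z_def)
qed

text \<open>On the range of \<open>Q\<close> the correction multiplies direction \<open>k\<close> by
  \<open>1 + \<rho> / ((lam k)\<^sup>2 + \<rho>)\<close>, which turns the ridge filter into
  \<open>wgt k\<close>.\<close>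

lemma theta_tilde_eq:
  assumes y: "y \<in> carrier_vec n"
  shows "theta_tilde X Q (diagm r lam) \<rho> y
    = Q *\<^sub>v vec r (\<lambda>k. wgt k * (transpose_mat P *\<^sub>v y) $ k)"
proof -
  define z where "z = transpose_mat P *\<^sub>v y"
  define u where "u = vec r (\<lambda>k. lam k / ((lam k)\<^sup>2 + \<rho>) * z $ k)"
  define D where "D = diagm r (\<lambda>k. 1 / ((lam k)\<^sup>2 + \<rho>))"
  have u: "u \<in> carrier_vec r" by (simp add: u_def)
  have D: "D \<in> carrier_mat r r" by (simp add: D_def)
  have "diagm r lam * diagm r lam + \<rho> \<cdot>\<^sub>m 1\<^sub>m r = diagm r (\<lambda>k. (lam k)\<^sup>2 + \<rho>)"
    unfolding diagm_mult by (rule eq_matI) (auto simp: diagm_def power2_eq_square)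
  then have m: "minv (diagm r lam * diagm r lam + \<rho> \<cdot>\<^sub>m 1\<^sub>m r) = D"
    unfolding D_def using lam_sq_pos by (simp add: minv_diagm less_imp_neq[symmetric])
  have "theta_tilde X Q (diagm r lam) \<rho> y = Q *\<^sub>v u + \<rho> \<cdot>\<^sub>v ((Q * D * transpose_mat Q) *\<^sub>v (Q *\<^sub>v u))"
    using carriers m by (simp add: theta_tilde_def ridge_eq[OF y] u_def z_def Let_def)
  also have "(Q * D * transpose_mat Q) *\<^sub>v (Q *\<^sub>v u) = Q *\<^sub>v (D *\<^sub>v ((transpose_mat Q * Q) *\<^sub>v u))"
    using carriers u D
    by (simp add: assoc_mult_mat_vec[of _ p r _ p] assoc_mult_mat_vec[of _ p r _ r] assoc_mult_mat_vec[of _ r p _ r])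
  also have "(transpose_mat Q * Q) *\<^sub>v u = u" using u by (simp add: Q_orth)
  also have "Q *\<^sub>v u + \<rho> \<cdot>\<^sub>v (Q *\<^sub>v (D *\<^sub>v u)) = Q *\<^sub>v (u + \<rho> \<cdot>\<^sub>v (D *\<^sub>v u))"
    using carriers u D by (simp add: mult_mat_vec[of _ p r] mult_add_distrib_mat_vec[of _ p r])
  also have "u + \<rho> \<cdot>\<^sub>v (D *\<^sub>v u) = vec r (\<lambda>k. wgt k * z $ k)"
  proof (rule eq_vecI)
    fix k assume "k < dim_vec (vec r (\<lambda>k. wgt k * z $ k))"
    then show "(u + \<rho> \<cdot>\<^sub>v (D *\<^sub>v u)) $ k = vec r (\<lambda>k. wgt k * z $ k) $ k"
      using u by (simp add: D_def diagm_mult_vec u_def wgt_def power2_eq_square algebra_simps)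
  qed (use u D in auto)
  finally show ?thesis by (simp add: z_def)
qed

lemma resp_carrier: "resp e \<in> carrier_vec n"
  using carriers by simp

lemma X_beta: "X *\<^sub>v \<beta> = P *\<^sub>v (diagm r lam *\<^sub>v zeta)"
  unfolding svd zeta_def using carriers
  by (simp add: assoc_mult_mat_vec[of _ n r _ p] assoc_mult_mat_vec[of _ n r _ r])

lemma P_transpose_resp:
  assumes k: "k < r"
  shows "(transpose_mat P *\<^sub>v resp e) $ k = lam k * zeta $ k + score e k"
proof -
  have "transpose_mat P *\<^sub>v (X *\<^sub>v \<beta>) = (transpose_mat P * P) *\<^sub>v (diagm r lam *\<^sub>v zeta)"
    using carriers by (simp add: X_beta assoc_mult_mat_vec[of _ r n _ r] diagm_mult_vec)
  then have 1: "transpose_mat P *\<^sub>v (X *\<^sub>v \<beta>) = diagm r lam *\<^sub>v zeta"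
    by (simp add: P_orth diagm_mult_vec)
  have 2: "(transpose_mat P *\<^sub>v vec n e) $ k = score e k"
    by (subst mult_mat_vec_index_sum[of _ r n]) (use k carriers in \<open>auto simp: score_def\<close>)
  have "transpose_mat P *\<^sub>v resp e = transpose_mat P *\<^sub>v (X *\<^sub>v \<beta>) + transpose_mat P *\<^sub>v vec n e"
    using carriers by (intro mult_add_distrib_mat_vec[of _ r n]) auto
  then show ?thesis using k carriers 2 by (simp add: 1 diagm_mult_vec)
qed

lemma tt_carrier: "tt e \<in> carrier_vec p"
  unfolding theta_tilde_eq[OF resp_carrier] using carriers by simp

lemma tt_error_index:
  assumes j: "j < p"
  shows "tt e $ j - theta $ j = (\<Sum>k<r. Q $$ (j, k) * (- (shrink k * zeta $ k) + wgt k * score e k))"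
proof -
  have "tt e $ j = (\<Sum>k<r. Q $$ (j, k) * (wgt k * (lam k * zeta $ k + score e k)))"
    unfolding theta_tilde_eq[OF resp_carrier]
    by (subst mult_mat_vec_index_sum) (use j carriers P_transpose_resp in auto)
  then have "tt e $ j - theta $ j
      = (\<Sum>k<r. Q $$ (j, k) * (wgt k * (lam k * zeta $ k + score e k)) - Q $$ (j, k) * zeta $ k)"
    using j by (simp add: theta_index sum_subtractf)
  also have "\<dots> = (\<Sum>k<r. Q $$ (j, k) * (- (shrink k * zeta $ k) + wgt k * score e k))"
  proof (intro sum.cong refl)
    fix k
    have a: "(lam k)\<^sup>2 + \<rho> \<noteq> 0" using lam_sq_pos[of k] by simp
    \<comment> \<open>With \<open>q = \<rho> / ((lam k)\<^sup>2 + \<rho>)\<close> this reads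
      \<open>(1 - q) * (1 + q) - 1 = - q\<^sup>2\<close>.\<close>
    have "wgt k * lam k - 1 = - shrink k"
      unfolding wgt_def shrink_def using a
      by (simp add: divide_simps) (simp add: power2_eq_square algebra_simps)
    then have "wgt k * lam k = 1 - shrink k" by simp
    then have "wgt k * (lam k * zeta $ k) = (1 - shrink k) * zeta $ k" by (metis mult.assoc)
    then show "Q $$ (j, k) * (wgt k * (lam k * zeta $ k + score e k)) - Q $$ (j, k) * zeta $ k
      = Q $$ (j, k) * (- (shrink k * zeta $ k) + wgt k * score e k)"
      by (simp add: distrib_left left_diff_distrib right_diff_distrib)
  qed
  finally show ?thesis .
qed

lemma functional_error:
  "(\<Sum>k<r. d k * (- (shrink k * zeta $ k) + wgt k * score e k)) = bias d + (\<Sum>l<n. noise_coef d l * e l)"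
proof -
  have "(\<Sum>k<r. d k * (wgt k * score e k)) = (\<Sum>k<r. \<Sum>l<n. d k * wgt k * P $$ (l, k) * e l)"
    by (simp add: score_def sum_distrib_left mult_ac)
  also have "\<dots> = (\<Sum>l<n. \<Sum>k<r. d k * wgt k * P $$ (l, k) * e l)" by (rule sum.swap)
  also have "\<dots> = (\<Sum>l<n. noise_coef d l * e l)" by (simp add: noise_coef_def sum_distrib_right)
  finally show ?thesis by (simp only: bias_def distrib_left sum.distrib)
qed

lemma P_orth_sum: "k < r \<Longrightarrow> k' < r \<Longrightarrow> (\<Sum>l<n. P $$ (l, k) * P $$ (l, k')) = (if k = k' then 1 else 0)"
  by (rule orthonormal_columns_sum[OF P_carrier P_orth])

lemma Q_orth_sum: "k < r \<Longrightarrow> k' < r \<Longrightarrow> (\<Sum>l<p. Q $$ (l, k) * Q $$ (l, k')) = (if k = k' then 1 else 0)"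
  by (rule orthonormal_columns_sum[OF Q_carrier Q_orth])

lemma noise_coef_sq_sum:
  assumes "\<And>k. k < r \<Longrightarrow> (wgt k)\<^sup>2 \<le> W" "(\<Sum>k<r. (d k)\<^sup>2) \<le> D" "W \<ge> 0"
  shows "(\<Sum>l<n. (noise_coef d l)\<^sup>2) \<le> W * D"
proof -
  have "(\<Sum>l<n. (noise_coef d l)\<^sup>2) = (\<Sum>k<r. (d k * wgt k)\<^sup>2)"
    unfolding noise_coef_def by (rule sum_power2_orthonormal_combination[OF P_orth_sum])
  also have "\<dots> \<le> (\<Sum>k<r. W * (d k)\<^sup>2)"
    using assms(1) by (intro sum_mono) (auto simp: power_mult_distrib mult.commute[of "(d _)\<^sup>2"] intro!: mult_right_mono)
  also have "\<dots> \<le> W * D" using assms by (simp flip: sum_distrib_left add: mult_left_mono)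
  finally show ?thesis .
qed

lemma zeta_norm: "(\<Sum>k<r. (zeta $ k)\<^sup>2) = (vnorm theta)\<^sup>2"
proof -
  have "(vnorm theta)\<^sup>2 = (\<Sum>j<p. (theta $ j)\<^sup>2)"
    using theta_carrier by (simp add: vnorm_def sum_nonneg)
  also have "\<dots> = (\<Sum>j<p. (\<Sum>k<r. zeta $ k * Q $$ (j, k))\<^sup>2)"
    by (simp add: theta_index mult.commute)
  also have "\<dots> = (\<Sum>k<r. (zeta $ k)\<^sup>2)"
    by (rule sum_power2_orthonormal_combination[OF Q_orth_sum])
  finally show ?thesis by simp
qed

lemma bias_sq_le:
  assumes "\<And>k. k < r \<Longrightarrow> (shrink k)\<^sup>2 \<le> B" "(\<Sum>k<r. (d k)\<^sup>2) \<le> D" "B \<ge> 0"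
  shows "(bias d)\<^sup>2 \<le> B * (vnorm theta)\<^sup>2 * D"
proof -
  have "(bias d)\<^sup>2 \<le> (\<Sum>k<r. (d k)\<^sup>2) * (\<Sum>k<r. (- (shrink k * zeta $ k))\<^sup>2)"
    unfolding bias_def by (rule Cauchy_Schwarz_ineq_sum)
  also have "\<dots> \<le> D * (\<Sum>k<r. B * (zeta $ k)\<^sup>2)"
    using assms by (intro mult_mono sum_mono)
      (auto simp: power_mult_distrib intro!: mult_right_mono sum_nonneg order_trans[OF sum_nonneg assms(2)])
  also have "\<dots> = B * (vnorm theta)\<^sup>2 * D" by (simp flip: sum_distrib_left zeta_norm)
  finally show ?thesis .
qed

text \<open>Bessel's inequality for the \<open>j\<close>-th unit vector. It makes every coordinate
  of the error a functional with coefficient norm at most one, although only the columns of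
  \<open>Q\<close> are orthonormal.\<close>

lemma Q_row_norm_le: "j < p \<Longrightarrow> (\<Sum>k<r. (Q $$ (j, k))\<^sup>2) \<le> 1"
  using Bessel_inequality_sum[OF Q_orth_sum, of r "\<lambda>l. if l = j then 1 else 0"]
  by (simp add: if_distrib[of "\<lambda>x. x\<^sup>2"] if_distrib[of "(*) _"] cong: if_cong)

lemma X_norm_le:
  assumes v: "v \<in> carrier_vec p" and L: "\<And>k. k < r \<Longrightarrow> (lam k)\<^sup>2 \<le> L" "L \<ge> 0"
  shows "(\<Sum>l<n. ((X *\<^sub>v v) $ l)\<^sup>2) \<le> L * (\<Sum>j<p. (v $ j)\<^sup>2)"
proof -
  define c where "c = transpose_mat Q *\<^sub>v v"
  have c: "c \<in> carrier_vec r" using carriers by (simp add: c_def)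
  have ck: "c $ k = (\<Sum>j<p. Q $$ (j, k) * v $ j)" if "k < r" for k
    unfolding c_def by (subst mult_mat_vec_index_sum[of _ r p]) (use that v carriers in auto)
  have "X *\<^sub>v v = P *\<^sub>v vec r (\<lambda>k. lam k * c $ k)"
    unfolding svd c_def using carriers v
    by (simp add: assoc_mult_mat_vec[of _ n r _ p] assoc_mult_mat_vec[of _ n r _ r] diagm_mult_vec)
  then have "(X *\<^sub>v v) $ l = (\<Sum>k<r. (lam k * c $ k) * P $$ (l, k))" if "l < n" for l
    using that carriers by (simp del: index_mult_mat_vec add: mult_mat_vec_index_sum[of _ n r] mult.commute)
  then have "(\<Sum>l<n. ((X *\<^sub>v v) $ l)\<^sup>2) = (\<Sum>l<n. (\<Sum>k<r. (lam k * c $ k) * P $$ (l, k))\<^sup>2)"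
    by simp
  also have "\<dots> = (\<Sum>k<r. (lam k * c $ k)\<^sup>2)"
    by (rule sum_power2_orthonormal_combination[OF P_orth_sum])
  also have "\<dots> \<le> (\<Sum>k<r. L * (c $ k)\<^sup>2)"
    using L by (intro sum_mono) (simp add: power_mult_distrib mult_right_mono)
  also have "\<dots> = L * (\<Sum>k<r. (\<Sum>j<p. Q $$ (j, k) * v $ j)\<^sup>2)"
    by (simp add: ck flip: sum_distrib_left)
  also have "\<dots> \<le> L * (\<Sum>j<p. (v $ j)\<^sup>2)"
    using L by (intro mult_left_mono Bessel_inequality_sum Q_orth_sum) auto
  finally show ?thesis .
qed

text \<open>The rows of \<open>X\<close> lie in the span of the columns of \<open>Q\<close>. Hence
  fitted values see only \<open>theta\<close>, while \<open>proj Qp \<beta>\<close> reappears as a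
  remainder in the error of the contrasts.\<close>

lemma X_theta: "X *\<^sub>v theta = X *\<^sub>v \<beta>"
  unfolding theta_eq X_mult_Q[OF zeta_carrier] X_beta ..

lemma theta_add_perp: "theta + proj Qp \<beta> = \<beta>"
proof -
  have "theta + proj Qp \<beta> = (Q * transpose_mat Q + Qp * transpose_mat Qp) *\<^sub>v \<beta>"
    unfolding proj_def using carriers by (intro add_mult_distrib_mat_vec[symmetric, of _ p p]) auto
  then show ?thesis using carriers by (simp add: perp_sum)
qed

text \<open>\<open>wgt k\<close> is \<open>lam k / S\<close> times \<open>1 + \<rho> / S\<close>,
  where \<open>S\<close> exceeds both \<open>(lam k)\<^sup>2\<close> and
  \<open>\<rho>\<close>.\<close>

lemma wgt_le: "k < r \<Longrightarrow> 0 \<le> wgt k \<and> wgt k \<le> 2 / lam k"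
proof -
  assume k: "k < r"
  define S where "S = (lam k)\<^sup>2 + \<rho>"
  have S: "S > 0" "S \<ge> (lam k)\<^sup>2" "S \<ge> \<rho>" using lam_sq_pos[of k] \<rho>_pos by (auto simp: S_def)
  have "lam k / S \<le> lam k / (lam k)\<^sup>2"
    using S lam_pos[OF k] by (intro divide_left_mono) auto
  then have 1: "lam k / S \<le> 1 / lam k" using lam_pos[OF k] by (simp add: power2_eq_square)
  have "\<rho> * lam k / S\<^sup>2 = (\<rho> / S) * (lam k / S)" by (simp add: power2_eq_square)
  also have "\<dots> \<le> 1 * (lam k / S)" using S lam_pos[OF k] by (intro mult_right_mono) auto
  finally have "wgt k \<le> 2 / lam k" using 1 by (simp add: wgt_def S_def)
  moreover have "wgt k \<ge> 0" using S lam_pos[OF k] \<rho>_pos by (simp add: wgt_def)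
  ultimately show ?thesis by simp
qed

lemma shrink_le: "k < r \<Longrightarrow> 0 \<le> shrink k \<and> shrink k \<le> \<rho>\<^sup>2 / (lam k) ^ 4"
proof -
  assume k: "k < r"
  have "((lam k)\<^sup>2)\<^sup>2 \<le> ((lam k)\<^sup>2 + \<rho>)\<^sup>2" using \<rho>_pos by (intro power_mono) auto
  then have "\<rho>\<^sup>2 / ((lam k)\<^sup>2 + \<rho>)\<^sup>2 \<le> \<rho>\<^sup>2 / ((lam k)\<^sup>2)\<^sup>2"
    using lam_pos[OF k] zero_less_power[OF lam_sq_pos[of k], of 2] by (intro divide_left_mono mult_pos_pos) auto
  then show ?thesis by (simp add: shrink_def)
qed

section \<open>Thresholding and error decompositions\<close>

definition row :: "nat \<Rightarrow> nat \<Rightarrow> real" where "row j k = Q $$ (j, k)"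

lemma tt_error:
  assumes "j < p"
  shows "tt e $ j - theta $ j = bias (row j) + (\<Sum>l<n. noise_coef (row j) l * e l)"
  unfolding tt_error_index[OF assms] functional_error[symmetric] by (simp add: row_def)

lemma Nset_subset: "Nset b theta \<subseteq> {..<p}"
  using theta_carrier by (auto simp: Nset_def)

text \<open>The margin \<open>(1 - cb) * b\<close> is what a small coordinate can bear:
  \<open>cb * b + (1 - cb) * b = b\<close>, and membership in \<open>Nset\<close> needs a strict
  inequality. A large coordinate has more room, because \<open>1 / cb + cb > 2\<close> leaves
  \<open>b / cb - (1 - cb) * b\<close> above \<open>b\<close>.\<close>

lemma Nset_eqI:
  assumes cb: "0 < cb" "cb < 1" and b: "b > 0"
    and sep: "\<And>i. i < p \<Longrightarrow> (i \<notin> Nset b theta \<longrightarrow> \<bar>theta $ i\<bar> \<le> cb * b)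
                    \<and> (i \<in> Nset b theta \<longrightarrow> \<bar>theta $ i\<bar> \<ge> b / cb)"
    and err: "\<And>i. i < p \<Longrightarrow> \<bar>tt e $ i - theta $ i\<bar> \<le> (1 - cb) * b"
  shows "Nset b (tt e) = Nset b theta"
proof -
  have dims: "dim_vec (tt e) = p" "dim_vec theta = p"
    using carrier_vecD[OF tt_carrier[of e]] carrier_vecD[OF theta_carrier] by auto
  have "(cb - 1)\<^sup>2 > 0" using cb by simp
  then have "2 * cb < 1 + cb * cb" by (simp add: power2_eq_square algebra_simps)
  then have "2 - cb < 1 / cb" using cb by (simp add: field_simps)
  then have "(2 - cb) * b < 1 / cb * b" using b by (intro mult_strict_right_mono)
  then have gap: "b / cb - (1 - cb) * b > b" by (simp add: algebra_simps)
  have "b < \<bar>tt e $ i\<bar> \<longleftrightarrow> b < \<bar>theta $ i\<bar>" if i: "i < p" for i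
  proof (cases "i \<in> Nset b theta")
    case True
    then have "\<bar>theta $ i\<bar> \<ge> b / cb" "b < \<bar>theta $ i\<bar>" using sep[OF i] by (auto simp: Nset_def)
    then show ?thesis using err[OF i] gap by linarith
  next
    case False
    then have "\<bar>theta $ i\<bar> \<le> cb * b" "\<not> b < \<bar>theta $ i\<bar>" using sep[OF i] i dims by (auto simp: Nset_def)
    moreover have "cb * b + (1 - cb) * b = b" by (simp add: algebra_simps)
    ultimately show ?thesis using err[OF i] by linarith
  qed
  then show ?thesis by (auto simp: Nset_def dims)
qed

lemma theta_hat_index:
  assumes "Nset b (tt e) = Nset b theta" "j < p"
  shows "theta_hat b (tt e) $ j = (if j \<in> Nset b theta then tt e $ j else 0)"
  using assms carrier_vecD[OF tt_carrier[of e]] by (auto simp: theta_hat_def)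

lemma theta_hat_carrier: "theta_hat b (tt e) \<in> carrier_vec p"
  using tt_carrier[of e] by (auto simp: theta_hat_def)

text \<open>Under correct selection, thresholding removes exactly the coordinates outside
  \<open>Nset b theta\<close>, so the error is affine in \<open>e\<close>. Exchanging the sums over
  \<open>j\<close> and \<open>k\<close> collects the selected coordinates into \<open>ccoef\<close>;
  what remains is the discarded signal and the part of \<open>\<beta>\<close> invisible to
  \<open>X\<close>.\<close>

lemma gamma_error:
  assumes Mm: "Mm \<in> carrier_mat p1 p" and i: "i < p1"
    and sel: "Nset b (tt e) = Nset b theta"
  shows "(Mm *\<^sub>v theta_hat b (tt e)) $ i - (Mm *\<^sub>v \<beta>) $ i
    = bias (ccoef Mm Q (Nset b theta) i) + (\<Sum>l<n. noise_coef (ccoef Mm Q (Nset b theta) i) l * e l)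
      - (\<Sum>j\<in>{..<p} - Nset b theta. Mm $$ (i, j) * theta $ j)
      - (\<Sum>j<p. Mm $$ (i, j) * proj Qp \<beta> $ j)"
proof -
  let ?N = "Nset b theta"
  define g where "g k = - (shrink k * zeta $ k) + wgt k * score e k" for k
  have fin: "finite {..<p}" by simp
  have "(Mm *\<^sub>v theta_hat b (tt e)) $ i = (\<Sum>j<p. Mm $$ (i, j) * theta_hat b (tt e) $ j)"
    by (rule mult_mat_vec_index_sum[OF Mm theta_hat_carrier i])
  also have "\<dots> = (\<Sum>j<p. if j \<in> ?N then Mm $$ (i, j) * tt e $ j else 0)"
    by (intro sum.cong refl) (simp add: theta_hat_index[OF sel])
  also have "\<dots> = (\<Sum>j\<in>?N. Mm $$ (i, j) * tt e $ j)"
    using Nset_subset[of b] by (simp add: sum.inter_restrict[OF fin, symmetric] Int_absorb1)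
  finally have 1: "(Mm *\<^sub>v theta_hat b (tt e)) $ i = (\<Sum>j\<in>?N. Mm $$ (i, j) * tt e $ j)" .
  have "(Mm *\<^sub>v \<beta>) $ i = (\<Sum>j<p. Mm $$ (i, j) * \<beta> $ j)"
    by (rule mult_mat_vec_index_sum[OF Mm \<beta>_carrier i])
  also have "\<dots> = (\<Sum>j<p. Mm $$ (i, j) * theta $ j + Mm $$ (i, j) * proj Qp \<beta> $ j)"
  proof (intro sum.cong refl)
    fix j assume "j \<in> {..<p}"
    then have "\<beta> $ j = theta $ j + proj Qp \<beta> $ j"
      using Qp_carrier by (subst theta_add_perp[symmetric]) (simp add: proj_def)
    then show "Mm $$ (i, j) * \<beta> $ j = Mm $$ (i, j) * theta $ j + Mm $$ (i, j) * proj Qp \<beta> $ j"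
      by (simp add: distrib_left)
  qed
  also have "\<dots> = (\<Sum>j\<in>?N. Mm $$ (i, j) * theta $ j) + (\<Sum>j\<in>{..<p} - ?N. Mm $$ (i, j) * theta $ j)
      + (\<Sum>j<p. Mm $$ (i, j) * proj Qp \<beta> $ j)"
    by (simp add: sum.distrib sum.subset_diff[OF Nset_subset[of b] fin])
  finally have 2: "(Mm *\<^sub>v \<beta>) $ i = (\<Sum>j\<in>?N. Mm $$ (i, j) * theta $ j)
      + (\<Sum>j\<in>{..<p} - ?N. Mm $$ (i, j) * theta $ j) + (\<Sum>j<p. Mm $$ (i, j) * proj Qp \<beta> $ j)" .
  have "(\<Sum>j\<in>?N. Mm $$ (i, j) * tt e $ j) - (\<Sum>j\<in>?N. Mm $$ (i, j) * theta $ j)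
      = (\<Sum>j\<in>?N. Mm $$ (i, j) * (tt e $ j - theta $ j))"
    by (simp add: sum_subtractf right_diff_distrib)
  also have "\<dots> = (\<Sum>j\<in>?N. \<Sum>k<r. Mm $$ (i, j) * Q $$ (j, k) * g k)"
    using Nset_subset[of b] by (intro sum.cong refl) (auto simp: tt_error_index sum_distrib_left g_def mult.assoc)
  also have "\<dots> = (\<Sum>k<r. \<Sum>j\<in>?N. Mm $$ (i, j) * Q $$ (j, k) * g k)" by (rule sum.swap)
  also have "\<dots> = (\<Sum>k<r. ccoef Mm Q ?N i k * g k)" by (simp add: ccoef_def sum_distrib_right)
  also have "\<dots> = bias (ccoef Mm Q ?N i) + (\<Sum>l<n. noise_coef (ccoef Mm Q ?N i) l * e l)"
    unfolding g_def by (rule functional_error)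
  finally show ?thesis using 1 2 by simp
qed

text \<open>The deterministic \<open>\<theta>'\<close>: what thresholding deletes even when the
  selection is right.\<close>

definition small_part :: "real \<Rightarrow> real vec" where
  "small_part b = vec p (\<lambda>j. if j \<in> Nset b theta then 0 else theta $ j)"

lemma small_part_sq_sum: "(\<Sum>j<p. (small_part b $ j)\<^sup>2) = (\<Sum>j\<in>{..<p} - Nset b theta. (theta $ j)\<^sup>2)"
proof -
  have "(\<Sum>j<p. (small_part b $ j)\<^sup>2) = (\<Sum>j\<in>{..<p} - Nset b theta. (small_part b $ j)\<^sup>2)"
    by (intro sum.mono_neutral_right) (auto simp: small_part_def)
  then show ?thesis by (simp add: small_part_def)
qed

text \<open>The residual is \<open>e l - w l + x l\<close>, with \<open>w\<close> from the errors on
  selected coordinates and \<open>x\<close> from the deleted signal. The weight \<open>t\<close> in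
  \<open>2 * \<bar>u\<bar> * \<bar>v\<bar> \<le> t * u\<^sup>2 + v\<^sup>2 / t\<close> replaces
  linear terms by squares, whose means can be computed; it will be set to the target rate. The sum
  of \<open>x\<close> against \<open>e\<close> is kept together so that its cancellation survives;
  for \<open>w\<close>, which depends on \<open>e\<close>, the inequality is applied term by
  term.\<close>

lemma sigma_error:
  fixes L t :: real
  assumes sel: "Nset b (tt e) = Nset b theta" and t: "t > 0" and n: "n > 0"
    and L: "\<And>k. k < r \<Longrightarrow> (lam k)\<^sup>2 \<le> L * n" "L \<ge> 0"
  shows "\<bar>sigma_hat2 X (resp e) (theta_hat b (tt e)) - s2\<bar> \<le>
     (t + ((\<Sum>l<n. (e l)\<^sup>2 - s2) / n)\<^sup>2 / t) / 2
     + (t + ((\<Sum>l<n. (X *\<^sub>v small_part b) $ l * e l) / n)\<^sup>2 / t)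
     + (t * (\<Sum>l<n. (e l)\<^sup>2) / n + L * (\<Sum>j\<in>Nset b theta. (tt e $ j - theta $ j)\<^sup>2) / t)
     + 2 * L * ((\<Sum>j\<in>Nset b theta. (tt e $ j - theta $ j)\<^sup>2) + (\<Sum>j\<in>{..<p} - Nset b theta. (theta $ j)\<^sup>2))"
proof -
  let ?N = "Nset b theta"
  define d where "d = vec p (\<lambda>j. if j \<in> ?N then tt e $ j - theta $ j else 0)"
  define x where "x l = (X *\<^sub>v small_part b) $ l" for l
  define w where "w l = (X *\<^sub>v d) $ l" for l
  define dsq where "dsq = (\<Sum>j\<in>?N. (tt e $ j - theta $ j)\<^sup>2)"
  define tsq where "tsq = (\<Sum>j\<in>{..<p} - ?N. (theta $ j)\<^sup>2)"
  have c: "d \<in> carrier_vec p" "small_part b \<in> carrier_vec p" "theta \<in> carrier_vec p"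
    using theta_carrier by (auto simp: d_def small_part_def)
  have "(\<Sum>j<p. (d $ j)\<^sup>2) = (\<Sum>j<p. if j \<in> ?N then (tt e $ j - theta $ j)\<^sup>2 else 0)"
    by (intro sum.cong) (auto simp: d_def)
  also have "\<dots> = dsq" unfolding dsq_def
    using Nset_subset[of b] by (simp add: sum.inter_restrict[OF finite_lessThan, symmetric] Int_absorb1)
  finally have w: "(\<Sum>l<n. (w l)\<^sup>2) \<le> L * n * dsq"
    using X_norm_le[OF c(1) L(1)] L(2) by (simp add: w_def)
  have x: "(\<Sum>l<n. (x l)\<^sup>2) \<le> L * n * tsq"
    using X_norm_le[OF c(2) L(1)] L(2) by (simp add: x_def small_part_sq_sum tsq_def)
  have "theta_hat b (tt e) = theta + d - small_part b"
    by (rule eq_vecI)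
       (use c theta_hat_carrier[of b e] theta_hat_index[OF sel] in \<open>auto simp: d_def small_part_def\<close>)
  then have "X *\<^sub>v theta_hat b (tt e) = X *\<^sub>v \<beta> + X *\<^sub>v d - X *\<^sub>v small_part b"
    using carriers c by (simp add: mult_minus_distrib_mat_vec[of _ n p] mult_add_distrib_mat_vec[of _ n p] X_theta)
  then have res: "resp e $ l - (X *\<^sub>v theta_hat b (tt e)) $ l = e l - w l + x l" if "l < n" for l
    using that carriers c by (simp add: w_def x_def del: index_mult_mat_vec)
  have "dim_row X = n" using carriers by simp
  then have "sigma_hat2 X (resp e) (theta_hat b (tt e)) = (\<Sum>l<n. (e l - w l + x l)\<^sup>2) / n"
    unfolding sigma_hat2_def by (simp add: res del: index_mult_mat_vec index_add_vec)
  also have "(\<Sum>l<n. (e l - w l + x l)\<^sup>2)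
      = (\<Sum>l<n. (e l)\<^sup>2) + 2 * (\<Sum>l<n. x l * e l) - 2 * (\<Sum>l<n. e l * w l) + (\<Sum>l<n. (x l - w l)\<^sup>2)"
    by (simp add: power2_eq_square algebra_simps sum.distrib sum_subtractf sum_distrib_left)
  finally have eq: "sigma_hat2 X (resp e) (theta_hat b (tt e)) - s2
      = (\<Sum>l<n. (e l)\<^sup>2 - s2) / n + 2 * ((\<Sum>l<n. x l * e l) / n) - 2 * (\<Sum>l<n. e l * w l) / n + (\<Sum>l<n. (x l - w l)\<^sup>2) / n"
    using n by (simp add: sum_subtractf add_divide_distrib diff_divide_distrib)
  have amgm: "2 * \<bar>u\<bar> * \<bar>v\<bar> \<le> t * u\<^sup>2 + v\<^sup>2 / t" for u v :: real
  proof -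
    have "0 \<le> (t * \<bar>u\<bar> - \<bar>v\<bar>)\<^sup>2 / t" using t by simp
    also have "\<dots> = t * u\<^sup>2 + v\<^sup>2 / t - 2 * \<bar>u\<bar> * \<bar>v\<bar>"
      using t by (simp add: power2_diff power_mult_distrib field_simps power2_eq_square)
    finally show ?thesis by simp
  qed
  have a1: "\<bar>z\<bar> \<le> (t + z\<^sup>2 / t) / 2" for z :: real using amgm[of 1 z] by simp
  have "2 * \<bar>\<Sum>l<n. e l * w l\<bar> \<le> 2 * (\<Sum>l<n. \<bar>e l\<bar> * \<bar>w l\<bar>)"
    using sum_abs[of "\<lambda>l. e l * w l" "{..<n}"] by (simp add: abs_mult)
  also have "\<dots> \<le> (\<Sum>l<n. t * (e l)\<^sup>2 + (w l)\<^sup>2 / t)"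
    unfolding sum_distrib_left by (intro sum_mono) (use amgm in \<open>simp add: mult.assoc\<close>)
  also have "\<dots> = t * (\<Sum>l<n. (e l)\<^sup>2) + (\<Sum>l<n. (w l)\<^sup>2) / t"
    by (simp add: sum.distrib sum_distrib_left sum_divide_distrib)
  also have "\<dots> \<le> t * (\<Sum>l<n. (e l)\<^sup>2) + L * n * dsq / t"
    using w t by (intro add_left_mono divide_right_mono) auto
  finally have "\<bar>2 * (\<Sum>l<n. e l * w l) / n\<bar> \<le> (t * (\<Sum>l<n. (e l)\<^sup>2) + L * n * dsq / t) / n"
    by (simp add: divide_right_mono)
  also have "\<dots> = t * (\<Sum>l<n. (e l)\<^sup>2) / n + L * dsq / t" using n t by (simp add: field_simps)
  finally have b1: "\<bar>2 * (\<Sum>l<n. e l * w l) / n\<bar> \<le> t * (\<Sum>l<n. (e l)\<^sup>2) / n + L * dsq / t" .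
  have "(\<Sum>l<n. (x l - w l)\<^sup>2) \<le> (\<Sum>l<n. 2 * (x l)\<^sup>2 + 2 * (w l)\<^sup>2)"
  proof (rule sum_mono)
    fix l
    have "0 \<le> (x l + w l)\<^sup>2" by simp
    then show "(x l - w l)\<^sup>2 \<le> 2 * (x l)\<^sup>2 + 2 * (w l)\<^sup>2" by (simp add: power2_eq_square algebra_simps)
  qed
  also have "\<dots> = 2 * (\<Sum>l<n. (x l)\<^sup>2) + 2 * (\<Sum>l<n. (w l)\<^sup>2)" by (simp add: sum.distrib sum_distrib_left)
  also have "\<dots> \<le> 2 * L * n * (dsq + tsq)" using x w by (simp add: algebra_simps)
  finally have "(\<Sum>l<n. (x l - w l)\<^sup>2) / n \<le> 2 * L * n * (dsq + tsq) / n" by (rule divide_right_mono) simp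
  then have "(\<Sum>l<n. (x l - w l)\<^sup>2) / n \<le> 2 * L * (dsq + tsq)" using n by simp
  then have b2: "\<bar>(\<Sum>l<n. (x l - w l)\<^sup>2) / n\<bar> \<le> 2 * L * (dsq + tsq)" by (simp add: sum_nonneg)
  have "\<bar>A + 2 * B - C + D\<bar> \<le> (t + a) / 2 + (t + b) + E + F"
    if "\<bar>A\<bar> \<le> (t + a) / 2" "\<bar>B\<bar> \<le> (t + b) / 2" "\<bar>C\<bar> \<le> E" "\<bar>D\<bar> \<le> F" for A B C D E F a b :: real
    using that unfolding abs_le_iff by (auto simp: field_simps)
  from this[OF a1 a1 b1 b2] show ?thesis
    unfolding x_def[symmetric] dsq_def[symmetric] tsq_def[symmetric] eq .
qed

end

section \<open>Stochastic orders and tail bounds\<close>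

context prob_space
begin

text \<open>The instance \<open>m = 2\<close>, serving as a variance bound. It is applied to the
  errors and to their centred squares; for the latter, square integrability means a fourth moment of
  the errors.\<close>

lemma second_moment_linear_combination:
  fixes \<xi> :: "nat \<Rightarrow> 'a \<Rightarrow> real" and \<mu> :: real
  assumes ind: "indep_vars (\<lambda>_. borel) \<xi> UNIV"
    and int: "\<And>i. integrable M (\<xi> i)" "\<And>i. expectation (\<xi> i) = 0"
    and mom: "\<And>i. integrable M (\<lambda>\<omega>. (\<xi> i \<omega>)\<^sup>2)" "\<And>i. expectation (\<lambda>\<omega>. (\<xi> i \<omega>)\<^sup>2) \<le> \<mu>"
  obtains K where "K > 0" "\<And>a n. integrable M (\<lambda>\<omega>. (\<Sum>l<n. a l * \<xi> l \<omega>)\<^sup>2)"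
    "\<And>a n V. V > 0 \<Longrightarrow> (\<Sum>l<n. (a l)\<^sup>2) \<le> V \<Longrightarrow>
      expectation (\<lambda>\<omega>. (\<Sum>l<n. a l * \<xi> l \<omega>)\<^sup>2) \<le> K * V"
proof -
  have sq: "\<bar>x\<bar> powr 2 = x\<^sup>2" for x :: real by (cases "x = 0") auto
  show thesis
    by (rule moment_linear_combination[of 2 \<xi> \<mu>, unfolded sq]) (use assms that in \<open>auto\<close>)
qed

text \<open>Markov's inequality for the majorant \<open>W\<close>, after discarding the exceptional
  sets \<open>A n\<close>. Monotonicity of the measure asks for measurability of the larger set
  alone, so \<open>Z\<close> can be an arbitrary function.\<close>

lemma bigOpI_expectation:
  fixes W :: "nat \<Rightarrow> 'a \<Rightarrow> real"
  assumes A: "\<And>n. A n \<in> events" "(\<lambda>n. prob (A n)) \<longlonglongrightarrow> 0"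
    and a: "\<forall>\<^sub>F n in sequentially. a n > 0"
    and W: "\<forall>\<^sub>F n in sequentially. integrable M (W n) \<and> (\<forall>\<omega>. 0 \<le> W n \<omega>) \<and> expectation (W n) \<le> C * a n"
    and Z: "\<forall>\<^sub>F n in sequentially. \<forall>\<omega>\<in>space M - A n. \<bar>Z n \<omega>\<bar> \<le> W n \<omega>"
  shows "bigOp M Z a"
  unfolding bigOp_def
proof (intro allI impI)
  fix e :: real assume e: "e > 0"
  \<comment> \<open>The sign of \<open>C\<close> is unknown, so a positive \<open>D\<close> replaces
    it; \<open>C'\<close> then splits \<open>e\<close> evenly between the exceptional set and
    Markov's bound.\<close>
  define D where "D = \<bar>C\<bar> + 1"
  define C' where "C' = 2 * D / e"
  have D: "D > 0" "C \<le> D" by (auto simp: D_def)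
  have C'0: "C' > 0" using e D by (simp add: C'_def)
  have "C / C' \<le> D / C'" using C'0 D by (intro divide_right_mono) auto
  also have "\<dots> = e / 2" using e D by (simp add: C'_def)
  finally have C': "C' > 0" "C / C' \<le> e / 2" using C'0 by auto
  have "\<forall>\<^sub>F n in sequentially. prob (A n) < e / 2"
    using A(2) e by (intro order_tendstoD(2)) auto
  then have "\<forall>\<^sub>F n in sequentially. prob {\<omega> \<in> space M. \<bar>Z n \<omega>\<bar> > C' * a n} \<le> e"
    using a W Z
  proof eventually_elim
    case (elim n)
    have [measurable]: "W n \<in> borel_measurable M" using elim by auto
    define B where "B = {\<omega> \<in> space M. W n \<omega> \<ge> C' * a n}"
    have B: "B \<in> events" unfolding B_def by measurable
    have "prob {\<omega> \<in> space M. \<bar>Z n \<omega>\<bar> > C' * a n} \<le> prob (A n \<union> B)"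
      using elim A B by (intro finite_measure_mono) (force simp: B_def)+
    also have "\<dots> \<le> prob (A n) + prob B" using A B by (intro measure_Un_le) auto
    also have "prob B \<le> expectation (W n) / (C' * a n)"
      unfolding B_def using elim C' by (intro integral_Markov_inequality_measure[of _ _ "{}"]) auto
    also have "\<dots> \<le> C * a n / (C' * a n)" using elim C' by (intro divide_right_mono) auto
    also have "\<dots> = C / C'" using elim by simp
    finally show ?case using elim(1) C'(2) by linarith
  qed
  then show "\<exists>C N. \<forall>n\<ge>N. prob {\<omega> \<in> space M. \<bar>Z n \<omega>\<bar> > C * a n} \<le> e"
    unfolding eventually_sequentially by blast
qed

text \<open>Markov's inequality for the \<open>m\<close>-th power and a union bound. Solving for the
  level \<open>u\<close> turns the factor \<open>card I\<close> into the power \<open>1 / m\<close>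
  of a cardinality.\<close>

lemma prob_exceedance_moment_le:
  fixes Y :: "'i \<Rightarrow> 'a \<Rightarrow> real" and m \<kappa> u :: real
  assumes I: "finite I" and Y [measurable]: "\<And>i. i \<in> I \<Longrightarrow> Y i \<in> borel_measurable M"
    and int: "\<And>i. i \<in> I \<Longrightarrow> integrable M (\<lambda>\<omega>. \<bar>Y i \<omega>\<bar> powr m)"
    and mom: "\<And>i. i \<in> I \<Longrightarrow> expectation (\<lambda>\<omega>. \<bar>Y i \<omega>\<bar> powr m) \<le> \<kappa>"
    and u: "u > 0" and m: "m > 0"
  shows "{\<omega> \<in> space M. \<exists>i\<in>I. \<bar>Y i \<omega>\<bar> > u} \<in> events"
    and "prob {\<omega> \<in> space M. \<exists>i\<in>I. \<bar>Y i \<omega>\<bar> > u} \<le> card I * (\<kappa> / u powr m)"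
proof -
  have eq: "{\<omega> \<in> space M. \<exists>i\<in>I. \<bar>Y i \<omega>\<bar> > u} = (\<Union>i\<in>I. {\<omega> \<in> space M. \<bar>Y i \<omega>\<bar> > u})" by auto
  have meas: "{\<omega> \<in> space M. \<bar>Y i \<omega>\<bar> > u} \<in> events" if "i \<in> I" for i
    using that by measurable
  show "{\<omega> \<in> space M. \<exists>i\<in>I. \<bar>Y i \<omega>\<bar> > u} \<in> events"
    unfolding eq using I meas by auto
  have "prob {\<omega> \<in> space M. \<bar>Y i \<omega>\<bar> > u} \<le> \<kappa> / u powr m" if i: "i \<in> I" for i
  proof -
    have "prob {\<omega> \<in> space M. \<bar>Y i \<omega>\<bar> > u} \<le> prob {\<omega> \<in> space M. \<bar>Y i \<omega>\<bar> powr m \<ge> u powr m}"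
      using u m Y[OF i] by (intro finite_measure_mono) (auto intro!: powr_mono2)
    also have "\<dots> \<le> expectation (\<lambda>\<omega>. \<bar>Y i \<omega>\<bar> powr m) / u powr m"
      using u by (intro integral_Markov_inequality_measure[of _ _ "{}"] int[OF i]) auto
    also have "\<dots> \<le> \<kappa> / u powr m" using mom[OF i] by (intro divide_right_mono) auto
    finally show ?thesis .
  qed
  then have "(\<Sum>i\<in>I. prob {\<omega> \<in> space M. \<bar>Y i \<omega>\<bar> > u}) \<le> card I * (\<kappa> / u powr m)"
    using sum_bounded_above[of I "\<lambda>i. prob {\<omega> \<in> space M. \<bar>Y i \<omega>\<bar> > u}" "\<kappa> / u powr m"] by simp
  moreover have "prob (\<Union>i\<in>I. {\<omega> \<in> space M. \<bar>Y i \<omega>\<bar> > u}) \<le> (\<Sum>i\<in>I. prob {\<omega> \<in> space M. \<bar>Y i \<omega>\<bar> > u})"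
    using I meas by (intro finite_measure_subadditive_finite) auto
  ultimately show "prob {\<omega> \<in> space M. \<exists>i\<in>I. \<bar>Y i \<omega>\<bar> > u} \<le> card I * (\<kappa> / u powr m)"
    unfolding eq by linarith
qed

end

section \<open>Asymptotic rates\<close>

locale ridge_asymptotics = prob_space PS for PS :: "'a measure" +
  fixes eps :: "nat \<Rightarrow> 'a \<Rightarrow> real"
    and p r p1 :: "nat \<Rightarrow> nat"
    and X P Q Qp Mm :: "nat \<Rightarrow> real mat"
    and \<beta> :: "nat \<Rightarrow> real vec"
    and lam :: "nat \<Rightarrow> nat \<Rightarrow> real"
    and \<rho> b :: "nat \<Rightarrow> real"
    and \<eta> \<alpha>\<theta> clam Clam \<delta> m \<alpha>p Cb \<nu>b cb :: real
  assumes design: "\<And>n. ridge_design n (p n) (r n) (X n) (P n) (Q n) (Qp n) (lam n) (\<rho> n) (\<beta> n)"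
    and Mm_carrier: "\<And>n. Mm n \<in> carrier_mat (p1 n) (p n)"
    and clam_pos: "clam > 0" and Clam_pos: "Clam > 0" and \<eta>: "0 < \<eta>" "\<eta> \<le> 1/2"
    and lam_bounds: "\<forall>\<^sub>F n in sequentially. \<forall>k<r n. clam * real n powr \<eta> \<le> lam n k \<and> lam n k \<le> Clam * sqrt (real n)"
    and theta_norm: "(\<lambda>n. vnorm (proj (Q n) (\<beta> n))) \<in> O(\<lambda>n. real n powr \<alpha>\<theta>)"
    and \<rho>_order: "\<rho> \<in> O(\<lambda>n. real n powr (2 * \<eta> - \<delta>))" and \<delta>: "(\<eta> + \<alpha>\<theta>) / 2 < \<delta>"
    and indep_eps: "indep_vars (\<lambda>_. borel) eps UNIV"
    and eps_ident: "\<And>i. distr PS borel (eps i) = distr PS borel (eps 0)"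
    and eps_rv [measurable]: "\<And>i. eps i \<in> borel_measurable PS"
    and eps_mean: "integrable PS (eps 0)" "expectation (eps 0) = 0"
    and m: "m > 4" and eps_moment: "integrable PS (\<lambda>\<omega>. \<bar>eps 0 \<omega>\<bar> powr m)"
    and p_order: "(\<lambda>n. real (p n)) \<in> O(\<lambda>n. real n powr \<alpha>p)" and \<alpha>p: "0 \<le> \<alpha>p"
    and b_eq: "\<And>n. b n = Cb * real n powr (- \<nu>b)" and Cb: "Cb > 0" and \<nu>b: "\<nu>b + \<alpha>p / m - \<eta> < 0"
    and cb: "0 < cb" "cb < 1"
    and separation: "\<forall>\<^sub>F n in sequentially. \<forall>i<p n.
      (i \<notin> Nset (b n) (proj (Q n) (\<beta> n)) \<longrightarrow> \<bar>proj (Q n) (\<beta> n) $ i\<bar> \<le> cb * b n)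
      \<and> (i \<in> Nset (b n) (proj (Q n) (\<beta> n)) \<longrightarrow> \<bar>proj (Q n) (\<beta> n) $ i\<bar> \<ge> b n / cb)"
begin

sublocale R: ridge_design n "p n" "r n" "X n" "P n" "Q n" "Qp n" "lam n" "\<rho> n" "\<beta> n" for n
  by (rule design)

abbreviation N where "N n \<equiv> Nset (b n) (R.theta n)"
abbreviation noise where "noise n d \<omega> \<equiv> (\<Sum>l<n. R.noise_coef n d l * eps l \<omega>)"
abbreviation tt where "tt n \<omega> \<equiv> R.tt n (\<lambda>l. eps l \<omega>)"

section \<open>The common scale of bias and noise, and the selection event\<close>

lemma eps_identical:
  assumes [measurable]: "g \<in> borel_measurable borel"
  shows "integrable PS (\<lambda>\<omega>. g (eps i \<omega>)) \<longleftrightarrow> integrable PS (\<lambda>\<omega>. g (eps 0 \<omega>))"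
    and "expectation (\<lambda>\<omega>. g (eps i \<omega>)) = (expectation (\<lambda>\<omega>. g (eps 0 \<omega>)) :: real)"
proof -
  have "integrable (distr PS borel (eps i)) g \<longleftrightarrow> integrable (distr PS borel (eps 0)) g"
    by (simp add: eps_ident[of i])
  then show "integrable PS (\<lambda>\<omega>. g (eps i \<omega>)) \<longleftrightarrow> integrable PS (\<lambda>\<omega>. g (eps 0 \<omega>))"
    by (simp add: integrable_distr_eq)
  have "integral\<^sup>L (distr PS borel (eps i)) g = integral\<^sup>L (distr PS borel (eps 0)) g"
    by (simp add: eps_ident[of i])
  then show "expectation (\<lambda>\<omega>. g (eps i \<omega>)) = expectation (\<lambda>\<omega>. g (eps 0 \<omega>))"
    by (simp add: integral_distr)
qed

lemma eps_integrable: "integrable PS (eps i)" and eps_expectation: "expectation (eps i) = 0"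
  using eps_identical[of "\<lambda>x. x" i] eps_mean by auto

lemma eps_square_integrable: "integrable PS (\<lambda>\<omega>. (eps i \<omega>)\<^sup>2)"
  using integrable_power2_of_powr[OF eps_rv eps_moment] m eps_identical(1)[of "\<lambda>x. x\<^sup>2" i] by auto

lemma eps_square_expectation: "expectation (\<lambda>\<omega>. (eps i \<omega>)\<^sup>2) = expectation (\<lambda>\<omega>. (eps 0 \<omega>)\<^sup>2)"
  by (rule eps_identical(2)) simp

text \<open>The noise is of order \<open>1 / lam n k\<close>. In the bias,
  \<open>(\<rho> n)\<^sup>2 / (lam n k) ^ 4\<close> has exponent
  \<open>2 * (2 * \<eta> - \<delta>) - 4 * \<eta> = - 2 * \<delta>\<close> and the norm of
  \<open>theta\<close> adds \<open>\<alpha>\<theta>\<close>; the sum is below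
  \<open>- \<eta>\<close> precisely because
  \<open>(\<eta> + \<alpha>\<theta>) / 2 < \<delta>\<close>. The quantifier over \<open>d\<close>
  stands inside the eventual statement, so that one starting index serves the growing families of
  functionals.\<close>

lemma bias_noise_scale:
  obtains c where "c > 0" "\<forall>\<^sub>F n in sequentially. n > 0 \<and> (\<forall>d D. (\<Sum>k<r n. (d k)\<^sup>2) \<le> D \<longrightarrow>
    (\<Sum>l<n. (R.noise_coef n d l)\<^sup>2) \<le> (c * real n powr (- \<eta>))\<^sup>2 * D
    \<and> (R.bias n d)\<^sup>2 \<le> (c * real n powr (- \<eta>))\<^sup>2 * D)"
proof -
  obtain c\<rho> where c\<rho>: "c\<rho> > 0" "\<forall>\<^sub>F n in sequentially. norm (\<rho> n) \<le> c\<rho> * norm (real n powr (2 * \<eta> - \<delta>))"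
    using \<rho>_order by (elim landau_o.bigE)
  obtain c\<theta> where c\<theta>: "c\<theta> > 0" "\<forall>\<^sub>F n in sequentially. norm (vnorm (R.theta n)) \<le> c\<theta> * norm (real n powr \<alpha>\<theta>)"
    using theta_norm by (elim landau_o.bigE)
  \<comment> \<open>The first entry is the noise constant from \<open>wgt_le\<close>, the second the
    bias constant from \<open>shrink_le\<close> and the norm bound.\<close>
  define c where "c = max (2 / clam) (c\<rho>\<^sup>2 / clam ^ 4 * c\<theta>)"
  have c: "c > 0" "2 / clam \<le> c" "c\<rho>\<^sup>2 / clam ^ 4 * c\<theta> \<le> c" using clam_pos by (auto simp: c_def less_max_iff_disj)
  have "\<forall>\<^sub>F n in sequentially. n > 0 \<and> (\<forall>d D. (\<Sum>k<r n. (d k)\<^sup>2) \<le> D \<longrightarrow>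
    (\<Sum>l<n. (R.noise_coef n d l)\<^sup>2) \<le> (c * real n powr (- \<eta>))\<^sup>2 * D
    \<and> (R.bias n d)\<^sup>2 \<le> (c * real n powr (- \<eta>))\<^sup>2 * D)"
    using c\<rho>(2) c\<theta>(2) lam_bounds eventually_gt_at_top[of 0]
  proof eventually_elim
    case (elim n)
    define x where "x = real n"
    define h where "h = x powr (- \<eta>)"
    have x: "x \<ge> 1" "x > 0" using elim(4) by (auto simp: x_def)
    have h: "h > 0" "x powr \<eta> = 1 / h" using x by (auto simp: h_def powr_minus_divide)
    have lam: "clam * x powr \<eta> \<le> lam n k" if "k < r n" for k using elim(3) that by (simp add: x_def)
    have lam0: "clam * x powr \<eta> > 0" using clam_pos x by simp
    have wgt: "(R.wgt n k)\<^sup>2 \<le> (c * h)\<^sup>2" if k: "k < r n" for k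
    proof (rule power_mono)
      have "R.wgt n k \<le> 2 / lam n k" using R.wgt_le[OF k] by simp
      also have "\<dots> \<le> 2 / (clam * x powr \<eta>)" using lam[OF k] lam0 by (intro divide_left_mono) auto
      also have "\<dots> = 2 / clam * h" using h by simp
      also have "\<dots> \<le> c * h" using c h by (intro mult_right_mono) auto
      finally show "R.wgt n k \<le> c * h" .
    qed (use R.wgt_le[OF k] in auto)
    define S where "S = c\<rho>\<^sup>2 / clam ^ 4 * x powr (- 2 * \<delta>)"
    have S: "S \<ge> 0" by (simp add: S_def)
    have shrink: "(R.shrink n k)\<^sup>2 \<le> S\<^sup>2" if k: "k < r n" for k
    proof (rule power_mono)
      have "R.shrink n k \<le> (\<rho> n)\<^sup>2 / (lam n k) ^ 4" using R.shrink_le[OF k] by simp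
      also have "\<dots> \<le> (c\<rho> * x powr (2 * \<eta> - \<delta>))\<^sup>2 / (clam * x powr \<eta>) ^ 4"
        using elim(1) lam[OF k] lam0 R.\<rho>_pos[of n]
        by (intro frac_le power_mono zero_less_power less_imp_le[OF lam0]) (auto simp: x_def)
      also have "\<dots> = c\<rho>\<^sup>2 / clam ^ 4 * (x powr (2 * (2 * \<eta> - \<delta>)) / x powr (4 * \<eta>))"
        using x by (simp add: power_mult_distrib powr_power mult.commute)
      also have "\<dots> = S" by (simp add: S_def flip: powr_diff)
      finally show "R.shrink n k \<le> S" .
    qed (use R.shrink_le[OF k] in auto)
    have "S * vnorm (R.theta n) \<le> S * (c\<theta> * x powr \<alpha>\<theta>)"
      using elim(2) S by (intro mult_left_mono) (auto simp: x_def)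
    also have "\<dots> = c\<rho>\<^sup>2 / clam ^ 4 * c\<theta> * x powr (\<alpha>\<theta> - 2 * \<delta>)"
      by (simp add: S_def powr_diff powr_minus field_simps)
    also have "\<dots> \<le> c * h"
      using c \<delta> x c\<theta> unfolding h_def by (intro mult_mono powr_mono) auto
    finally have "(S * vnorm (R.theta n))\<^sup>2 \<le> (c * h)\<^sup>2"
      using S by (intro power_mono) (auto simp: vnorm_def intro!: mult_nonneg_nonneg sum_nonneg)
    then have Sv: "S\<^sup>2 * (vnorm (R.theta n))\<^sup>2 \<le> (c * h)\<^sup>2" by (simp add: power_mult_distrib)
    show ?case
    proof (intro conjI allI impI)
      fix d :: "nat \<Rightarrow> real" and D :: real assume D: "(\<Sum>k<r n. (d k)\<^sup>2) \<le> D"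
      have D0: "D \<ge> 0" by (rule order_trans[OF _ D]) (simp add: sum_nonneg)
      show "(\<Sum>l<n. (R.noise_coef n d l)\<^sup>2) \<le> (c * real n powr - \<eta>)\<^sup>2 * D"
        using R.noise_coef_sq_sum[OF wgt D] by (simp add: h_def x_def)
      have "(R.bias n d)\<^sup>2 \<le> S\<^sup>2 * (vnorm (R.theta n))\<^sup>2 * D"
        by (rule R.bias_sq_le[OF shrink D]) simp_all
      also have "\<dots> \<le> (c * h)\<^sup>2 * D" using Sv D0 by (rule mult_right_mono)
      finally show "(R.bias n d)\<^sup>2 \<le> (c * real n powr - \<eta>)\<^sup>2 * D" by (simp add: h_def x_def)
    qed (use elim in auto)
  qed
  with c(1) show thesis by (rule that)
qed

text \<open>The index set, the coefficients and the level will all vary with \<open>n\<close>, hence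
  their place under the eventual quantifier. The scale enters through the squared norm of
  \<open>noise_coef\<close>, which the moment bound raises to the power
  \<open>m / 2\<close>.\<close>

lemma noise_tail:
  obtains \<kappa> where "\<kappa> > 0" "\<forall>\<^sub>F n in sequentially. \<forall>(I :: nat set) d D u. finite I \<longrightarrow> D > 0 \<longrightarrow> u > 0 \<longrightarrow>
    (\<forall>i\<in>I. (\<Sum>k<r n. (d i k)\<^sup>2) \<le> D) \<longrightarrow>
    prob {\<omega> \<in> space PS. \<exists>i\<in>I. \<bar>noise n (d i) \<omega>\<bar> > u}
      \<le> card I * (\<kappa> * D powr (m / 2) * (real n powr (- \<eta>)) powr m / u powr m)"
proof -
  obtain c where c: "c > 0" and scale: "\<forall>\<^sub>F n in sequentially. n > 0 \<and> (\<forall>d D. (\<Sum>k<r n. (d k)\<^sup>2) \<le> D \<longrightarrow>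
    (\<Sum>l<n. (R.noise_coef n d l)\<^sup>2) \<le> (c * real n powr (- \<eta>))\<^sup>2 * D
    \<and> (R.bias n d)\<^sup>2 \<le> (c * real n powr (- \<eta>))\<^sup>2 * D)" by (rule bias_noise_scale)
  have mom: "integrable PS (\<lambda>\<omega>. \<bar>eps i \<omega>\<bar> powr m)"
    "expectation (\<lambda>\<omega>. \<bar>eps i \<omega>\<bar> powr m) \<le> expectation (\<lambda>\<omega>. \<bar>eps 0 \<omega>\<bar> powr m)" for i
    using eps_identical[of "\<lambda>x. \<bar>x\<bar> powr m" i] eps_moment by auto
  have m2: "2 \<le> m" using m by simp
  obtain K where K: "K > 0" "\<And>a n. integrable PS (\<lambda>\<omega>. \<bar>\<Sum>l<n. a l * eps l \<omega>\<bar> powr m)"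
    "\<And>a n V. V > 0 \<Longrightarrow> (\<Sum>l<n. (a l)\<^sup>2) \<le> V \<Longrightarrow>
      expectation (\<lambda>\<omega>. \<bar>\<Sum>l<n. a l * eps l \<omega>\<bar> powr m) \<le> K * V powr (m / 2)"
    by (rule moment_linear_combination[OF m2 indep_eps eps_integrable eps_expectation mom]) blast
  have "\<forall>\<^sub>F n in sequentially. \<forall>(I :: nat set) d D u. finite I \<longrightarrow> D > 0 \<longrightarrow> u > 0 \<longrightarrow>
    (\<forall>i\<in>I. (\<Sum>k<r n. (d i k)\<^sup>2) \<le> D) \<longrightarrow>
    prob {\<omega> \<in> space PS. \<exists>i\<in>I. \<bar>noise n (d i) \<omega>\<bar> > u}
      \<le> card I * (K * c powr m * D powr (m / 2) * (real n powr (- \<eta>)) powr m / u powr m)"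
    using scale
  proof eventually_elim
    case (elim n)
    show ?case
    proof (intro allI impI)
      fix I :: "nat set" and d and D u :: real
      assume I: "finite I" and D: "D > 0" and u: "u > 0" and d: "\<forall>i\<in>I. (\<Sum>k<r n. (d i k)\<^sup>2) \<le> D"
      define ch where "ch = c * real n powr (- \<eta>)"
      have ch: "ch > 0" using c elim by (simp add: ch_def)
      have "expectation (\<lambda>\<omega>. \<bar>noise n (d i) \<omega>\<bar> powr m) \<le> K * c powr m * D powr (m / 2) * (real n powr (- \<eta>)) powr m"
        if i: "i \<in> I" for i
      proof -
        have "expectation (\<lambda>\<omega>. \<bar>noise n (d i) \<omega>\<bar> powr m) \<le> K * (ch\<^sup>2 * D) powr (m / 2)"
        proof (rule K(3))
          show "(\<Sum>l<n. (R.noise_coef n (d i) l)\<^sup>2) \<le> ch\<^sup>2 * D"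
            using elim d i unfolding ch_def by blast
        qed (use ch D in simp)
        also have "(ch\<^sup>2 * D) powr (m / 2) = ch powr m * D powr (m / 2)"
          using D ch by (simp add: powr_mult power2_powr_half)
        also have "ch powr m = c powr m * (real n powr (- \<eta>)) powr m"
          using c by (simp add: ch_def powr_mult)
        finally show ?thesis by (simp add: mult_ac)
      qed
      then show "prob {\<omega> \<in> space PS. \<exists>i\<in>I. \<bar>noise n (d i) \<omega>\<bar> > u}
          \<le> card I * (K * c powr m * D powr (m / 2) * (real n powr (- \<eta>)) powr m / u powr m)"
        using u m by (intro prob_exceedance_moment_le I K) auto
    qed
  qed
  with K(1) c show thesis by (intro that[of "K * c powr m"]) auto
qed

text \<open>Half of the margin \<open>(1 - cb) * b n\<close> is granted to the noise, the other half
  to the bias. Off this event the selection is eventually correct, and both rates are derived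
  there.\<close>

definition exceed :: "nat \<Rightarrow> 'a set" where
  "exceed n = {\<omega> \<in> space PS. \<exists>j\<in>{..<p n}. \<bar>noise n (R.row n j) \<omega>\<bar> > (1 - cb) / 2 * b n}"

lemma exceed_events: "exceed n \<in> events"
  unfolding exceed_def by measurable

text \<open>A row of \<open>Q\<close> has norm at most one and the level is a multiple of
  \<open>b n\<close>, so one coordinate contributes the order
  \<open>n powr (m * \<nu>b - m * \<eta>)\<close>; the union over \<open>p n\<close> coordinates
  adds \<open>\<alpha>p\<close> to the exponent.\<close>

lemma prob_exceed: "(\<lambda>n. prob (exceed n)) \<in> O(\<lambda>n. real n powr (\<alpha>p + m * \<nu>b - m * \<eta>))"
proof -
  obtain \<kappa> where \<kappa>: "\<kappa> > 0" "\<forall>\<^sub>F n in sequentially. \<forall>(I :: nat set) d D u. finite I \<longrightarrow> D > 0 \<longrightarrow> u > 0 \<longrightarrow>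
    (\<forall>i\<in>I. (\<Sum>k<r n. (d i k)\<^sup>2) \<le> D) \<longrightarrow>
    prob {\<omega> \<in> space PS. \<exists>i\<in>I. \<bar>noise n (d i) \<omega>\<bar> > u}
      \<le> card I * (\<kappa> * D powr (m / 2) * (real n powr (- \<eta>)) powr m / u powr m)" by (rule noise_tail)
  obtain c\<^sub>p where c\<^sub>p: "c\<^sub>p > 0" "\<forall>\<^sub>F n in sequentially. norm (real (p n)) \<le> c\<^sub>p * norm (real n powr \<alpha>p)"
    using p_order by (elim landau_o.bigE)
  define v where "v = (1 - cb) / 2 * Cb"
  have v: "v > 0" using cb Cb by (simp add: v_def)
  have "\<forall>\<^sub>F n in sequentially. norm (prob (exceed n))
      \<le> (c\<^sub>p * \<kappa> / v powr m) * norm (real n powr (\<alpha>p + m * \<nu>b - m * \<eta>))"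
    using \<kappa>(2) c\<^sub>p(2) eventually_gt_at_top[of 0]
  proof eventually_elim
    case (elim n)
    define x where "x = real n"
    have x: "x > 0" using elim(3) by (simp add: x_def)
    have b: "(1 - cb) / 2 * b n = v * x powr (- \<nu>b)" by (simp add: b_eq v_def x_def)
    have "prob (exceed n) \<le> card {..<p n} * (\<kappa> * 1 powr (m / 2) * (x powr (- \<eta>)) powr m / (v * x powr (- \<nu>b)) powr m)"
      unfolding exceed_def b x_def
      by (rule elim(1)[rule_format]) (use v x R.Q_row_norm_le in \<open>auto simp: R.row_def x_def\<close>)
    also have "(x powr (- \<eta>)) powr m = x powr (- (m * \<eta>))"
      by (simp add: powr_powr mult.commute)
    also have "(v * x powr (- \<nu>b)) powr m = v powr m * x powr (- (m * \<nu>b))"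
      using v by (simp add: powr_mult powr_powr mult.commute)
    also have "card {..<p n} * (\<kappa> * 1 powr (m / 2) * x powr (- (m * \<eta>)) / (v powr m * x powr (- (m * \<nu>b))))
        = p n * (\<kappa> / v powr m * (x powr (- (m * \<eta>)) / x powr (- (m * \<nu>b))))"
      by simp
    also have "x powr (- (m * \<eta>)) / x powr (- (m * \<nu>b)) = x powr (m * \<nu>b - m * \<eta>)"
      by (simp flip: powr_diff)
    also have "p n * (\<kappa> / v powr m * x powr (m * \<nu>b - m * \<eta>)) \<le> (c\<^sub>p * x powr \<alpha>p) * (\<kappa> / v powr m * x powr (m * \<nu>b - m * \<eta>))"
      using elim(2) \<kappa>(1) by (intro mult_right_mono) (auto simp: x_def)
    also have "\<dots> = c\<^sub>p * \<kappa> / v powr m * x powr (\<alpha>p + m * \<nu>b - m * \<eta>)"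
      by (simp add: powr_diff powr_add)
    finally show ?case by (simp add: x_def)
  qed
  then show ?thesis by (rule bigoI)
qed

lemma prob_exceed_tendsto: "(\<lambda>n. prob (exceed n)) \<longlonglongrightarrow> 0"
proof -
  have "m * (\<nu>b + \<alpha>p / m - \<eta>) < m * 0" using \<nu>b m by (intro mult_strict_left_mono) auto
  then have neg: "\<alpha>p + m * \<nu>b - m * \<eta> < 0" using m by (simp add: algebra_simps)
  obtain c where c: "c > 0" "\<forall>\<^sub>F n in sequentially. norm (prob (exceed n)) \<le> c * norm (real n powr (\<alpha>p + m * \<nu>b - m * \<eta>))"
    using prob_exceed by (elim landau_o.bigE)
  have "(\<lambda>n. c * norm (real n powr (\<alpha>p + m * \<nu>b - m * \<eta>))) \<longlonglongrightarrow> c * norm (0 :: real)"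
    by (intro tendsto_intros tendsto_neg_powr[OF neg] filterlim_real_sequentially)
  then show ?thesis by (intro Lim_null_comparison[OF c(2)]) simp
qed

text \<open>From \<open>\<nu>b + \<alpha>p / m - \<eta> < 0\<close> and
  \<open>\<alpha>p \<ge> 0\<close> follows \<open>\<nu>b < \<eta>\<close>, so the bias is eventually
  below the half margin left by \<open>exceed\<close>.\<close>

lemma selection_consistent:
  "\<forall>\<^sub>F n in sequentially. \<forall>\<omega>\<in>space PS - exceed n. Nset (b n) (tt n \<omega>) = N n"
proof -
  obtain c where c: "c > 0" and scale: "\<forall>\<^sub>F n in sequentially. n > 0 \<and> (\<forall>d D. (\<Sum>k<r n. (d k)\<^sup>2) \<le> D \<longrightarrow>
    (\<Sum>l<n. (R.noise_coef n d l)\<^sup>2) \<le> (c * real n powr (- \<eta>))\<^sup>2 * D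
    \<and> (R.bias n d)\<^sup>2 \<le> (c * real n powr (- \<eta>))\<^sup>2 * D)" by (rule bias_noise_scale)
  have "\<alpha>p / m \<ge> 0" using \<alpha>p m by simp
  then have "\<nu>b - \<eta> < 0" using \<nu>b by simp
  then have "(\<lambda>n. real n powr (\<nu>b - \<eta>)) \<longlonglongrightarrow> 0"
    by (intro tendsto_neg_powr filterlim_real_sequentially)
  then have "\<forall>\<^sub>F n in sequentially. real n powr (\<nu>b - \<eta>) < (1 - cb) / 2 * Cb / c"
    using cb Cb c by (intro order_tendstoD(2)) auto
  then show ?thesis using scale separation
  proof eventually_elim
    case (elim n)
    have n: "real n > 0" using elim(2) by simp
    have b: "b n > 0" using n Cb by (simp add: b_eq)
    have small: "c * real n powr (- \<eta>) \<le> (1 - cb) / 2 * b n"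
    proof -
      have "c * real n powr (\<nu>b - \<eta>) \<le> (1 - cb) / 2 * Cb"
        using elim(1) c by (simp add: pos_less_divide_eq mult.commute)
      then have "c * real n powr (\<nu>b - \<eta>) * real n powr (- \<nu>b) \<le> (1 - cb) / 2 * Cb * real n powr (- \<nu>b)"
        by (rule mult_right_mono) simp
      then show ?thesis by (simp add: b_eq mult.assoc flip: powr_add)
    qed
    show ?case
    proof
      fix \<omega> assume \<omega>: "\<omega> \<in> space PS - exceed n"
      show "Nset (b n) (tt n \<omega>) = N n"
      proof (rule R.Nset_eqI[OF cb b])
        show "(i \<notin> N n \<longrightarrow> \<bar>R.theta n $ i\<bar> \<le> cb * b n) \<and> (i \<in> N n \<longrightarrow> b n / cb \<le> \<bar>R.theta n $ i\<bar>)"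
          if "i < p n" for i using elim(3) that by blast
        fix i assume i: "i < p n"
        have "(\<Sum>k<r n. (R.row n i k)\<^sup>2) \<le> 1"
          using R.Q_row_norm_le[OF i] by (simp add: R.row_def)
        then have "(R.bias n (R.row n i))\<^sup>2 \<le> (c * real n powr (- \<eta>))\<^sup>2 * 1"
          using elim(2) by blast
        then have "\<bar>R.bias n (R.row n i)\<bar> \<le> c * real n powr (- \<eta>)"
          using c by (simp add: abs_le_square_iff[symmetric] abs_mult)
        moreover have "\<bar>noise n (R.row n i) \<omega>\<bar> \<le> (1 - cb) / 2 * b n"
          using \<omega> i by (force simp: exceed_def)
        moreover have "(1 - cb) / 2 * b n + (1 - cb) / 2 * b n = (1 - cb) * b n" by simp
        ultimately show "\<bar>tt n \<omega> $ i - R.theta n $ i\<bar> \<le> (1 - cb) * b n"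
          unfolding R.tt_error[OF i] using small by linarith
      qed
    qed
  qed
qed

section \<open>Rates for the contrasts and for the error variance\<close>

abbreviation cc where "cc n \<equiv> ccoef (Mm n) (Q n) (N n)"
abbreviation calM where "calM n \<equiv> Mset (Mm n) (Q n) (N n)"

text \<open>Rows outside \<open>calM\<close> have zero coefficients, hence neither bias nor noise,
  and the union bound runs over \<open>calM\<close> alone. The factor
  \<open>card (calM n) powr (1 / m)\<close> in the level cancels the number of rows after the
  \<open>m\<close>-th power is taken.\<close>

lemma gamma_bigOp:
  assumes nonempty: "\<forall>\<^sub>F n in sequentially. calM n \<noteq> {}"
    and CM: "\<forall>\<^sub>F n in sequentially. \<forall>i\<in>calM n. (\<Sum>k<r n. (cc n i k)\<^sup>2) \<le> CM"
    and rem1: "(\<lambda>n. Max ((\<lambda>i. \<bar>\<Sum>j\<in>{..<p n} - N n. Mm n $$ (i,j) * R.theta n $ j\<bar>) ` {..<p1 n}))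
          \<in> o(\<lambda>n. 1 / sqrt (real n * ln (real n)))"
    and rem2: "(\<lambda>n. Max ((\<lambda>i. \<bar>\<Sum>j<p n. Mm n $$ (i,j) * proj (Qp n) (\<beta> n) $ j\<bar>) ` {..<p1 n}))
          \<in> o(\<lambda>n. 1 / sqrt (real n * ln (real n)))"
  shows "bigOp PS (\<lambda>n \<omega>. Max ((\<lambda>i. \<bar>(Mm n *\<^sub>v theta_hat (b n) (tt n \<omega>)) $ i - (Mm n *\<^sub>v \<beta> n) $ i\<bar>) ` {..<p1 n}))
                  (\<lambda>n. real (card (calM n)) powr (1 / m) * real n powr (- \<eta>))"
  unfolding bigOp_def
proof (intro allI impI)
  fix e :: real assume e: "e > 0"
  obtain c where c: "c > 0" and scale: "\<forall>\<^sub>F n in sequentially. n > 0 \<and> (\<forall>d D. (\<Sum>k<r n. (d k)\<^sup>2) \<le> D \<longrightarrow>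
    (\<Sum>l<n. (R.noise_coef n d l)\<^sup>2) \<le> (c * real n powr (- \<eta>))\<^sup>2 * D
    \<and> (R.bias n d)\<^sup>2 \<le> (c * real n powr (- \<eta>))\<^sup>2 * D)" by (rule bias_noise_scale)
  obtain \<kappa> where \<kappa>: "\<kappa> > 0" and tail: "\<forall>\<^sub>F n in sequentially. \<forall>(I :: nat set) d D u. finite I \<longrightarrow> D > 0 \<longrightarrow> u > 0 \<longrightarrow>
    (\<forall>i\<in>I. (\<Sum>k<r n. (d i k)\<^sup>2) \<le> D) \<longrightarrow>
    prob {\<omega> \<in> space PS. \<exists>i\<in>I. \<bar>noise n (d i) \<omega>\<bar> > u}
      \<le> card I * (\<kappa> * D powr (m / 2) * (real n powr (- \<eta>)) powr m / u powr m)" by (rule noise_tail)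
  \<comment> \<open>The maximum with 1 supplies the positivity that the tail bound asks of
    \<open>D\<close>; \<open>C\<close> then solves
    \<open>\<kappa> * D powr (m / 2) / C powr m = e / 2\<close>.\<close>
  define D where "D = max CM 1"
  have D: "D > 0" "CM \<le> D" by (auto simp: D_def)
  define C where "C = (2 * \<kappa> * D powr (m / 2) / e) powr (1 / m)"
  have C: "C > 0" "C powr m = 2 * \<kappa> * D powr (m / 2) / e"
    using \<kappa> D e m by (auto simp: C_def powr_powr)
  define h where "h n = real n powr (- \<eta>)" for n :: nat
  define Mc where "Mc n = real (card (calM n)) powr (1 / m)" for n
  \<comment> \<open>One share for the bias, two units for the two remainders, one share for the
    noise.\<close>
  define C' where "C' = c * sqrt D + 2 + C"
  have prob0: "\<forall>\<^sub>F n in sequentially. prob (exceed n) < e / 2"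
    using prob_exceed_tendsto e by (intro order_tendstoD(2)) auto
  have r1: "\<forall>\<^sub>F n in sequentially. norm (Max ((\<lambda>i. \<bar>\<Sum>j\<in>{..<p n} - N n. Mm n $$ (i,j) * R.theta n $ j\<bar>) ` {..<p1 n}))
      \<le> 1 * norm (1 / sqrt (real n * ln (real n)))"
    by (rule landau_o.smallD[OF rem1]) simp
  have r2: "\<forall>\<^sub>F n in sequentially. norm (Max ((\<lambda>i. \<bar>\<Sum>j<p n. Mm n $$ (i,j) * proj (Qp n) (\<beta> n) $ j\<bar>) ` {..<p1 n}))
      \<le> 1 * norm (1 / sqrt (real n * ln (real n)))"
    by (rule landau_o.smallD[OF rem2]) simp
  have "\<forall>\<^sub>F n in sequentially. prob {\<omega> \<in> space PS.
      \<bar>Max ((\<lambda>i. \<bar>(Mm n *\<^sub>v theta_hat (b n) (tt n \<omega>)) $ i - (Mm n *\<^sub>v \<beta> n) $ i\<bar>) ` {..<p1 n})\<bar> > C' * (Mc n * h n)} \<le> e"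
    using nonempty CM r1 r2 prob0 scale tail selection_consistent eventually_ge_at_top[of 3]
  proof eventually_elim
    case (elim n)
    have fin: "calM n \<subseteq> {..<p1 n}" "finite (calM n)"
      using Mm_carrier[of n] by (auto simp: Mset_def intro: finite_subset[of _ "{..<p1 n}"])
    \<comment> \<open>A nonempty set of rows makes \<open>Max\<close> an attained value; on the
      empty set it would be unspecified.\<close>
    then have p1: "{..<p1 n} \<noteq> {}" using elim(1) by blast
    have h: "h n > 0" using elim(9) by (simp add: h_def)
    have card: "card (calM n) \<ge> 1" using elim(1) fin by (simp add: Suc_leI card_gt_0_iff)
    then have Mc: "Mc n \<ge> 1" using m by (simp add: Mc_def ge_one_powr_ge_zero)
    \<comment> \<open>\<open>n \<ge> 3\<close> exceeds \<open>exp 1\<close>, so the logarithm is at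
      least 1 and the bound on the remainders falls below \<open>n powr (- 1 / 2)\<close>, which
      \<open>\<eta> \<le> 1/2\<close> puts below \<open>h n\<close>.\<close>
    have "exp 1 \<le> real n" using exp_le elim(9) by linarith
    then have ln: "ln (real n) \<ge> 1" using elim(9) by (subst ln_ge_iff) auto
    have "1 / sqrt (real n * ln (real n)) \<le> 1 / sqrt (real n)"
      using ln elim(9) by (intro divide_left_mono) auto
    also have "\<dots> = real n powr (- (1/2))" using elim(9) by (simp add: powr_minus_divide powr_half_sqrt)
    also have "\<dots> \<le> h n" unfolding h_def using \<eta> elim(9) by (intro powr_mono) auto
    finally have small: "norm (1 / sqrt (real n * ln (real n))) \<le> h n" using ln by simp
    have rem: "\<bar>\<Sum>j\<in>{..<p n} - N n. Mm n $$ (i,j) * R.theta n $ j\<bar> \<le> h n"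
        "\<bar>\<Sum>j<p n. Mm n $$ (i,j) * proj (Qp n) (\<beta> n) $ j\<bar> \<le> h n" if i: "i < p1 n" for i
    proof -
      have Max_le: "f i \<le> norm (Max (f ` {..<p1 n}))" for f :: "nat \<Rightarrow> real"
      proof -
        have "f i \<le> Max (f ` {..<p1 n})" using i by (intro Max_ge) auto
        then show ?thesis by simp
      qed
      show "\<bar>\<Sum>j\<in>{..<p n} - N n. Mm n $$ (i,j) * R.theta n $ j\<bar> \<le> h n"
        using Max_le[of "\<lambda>i. \<bar>\<Sum>j\<in>{..<p n} - N n. Mm n $$ (i,j) * R.theta n $ j\<bar>"] elim(3) small
        by linarith
      show "\<bar>\<Sum>j<p n. Mm n $$ (i,j) * proj (Qp n) (\<beta> n) $ j\<bar> \<le> h n"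
        using Max_le[of "\<lambda>i. \<bar>\<Sum>j<p n. Mm n $$ (i,j) * proj (Qp n) (\<beta> n) $ j\<bar>"] elim(4) small
        by linarith
    qed
    define u where "u = C * (Mc n * h n)"
    have u: "u > 0" using C h Mc by (simp add: u_def)
    define B where "B = {\<omega> \<in> space PS. \<exists>i\<in>calM n. \<bar>noise n (cc n i) \<omega>\<bar> > u}"
    have B: "B \<in> events" unfolding B_def using fin by measurable
    have cn: "(\<Sum>k<r n. (cc n i k)\<^sup>2) \<le> D" if "i \<in> calM n" for i using elim(2) that D by force
    have "prob B \<le> card (calM n) * (\<kappa> * D powr (m / 2) * h n powr m / u powr m)"
      unfolding B_def h_def by (rule elim(7)[rule_format]) (use fin D u cn in auto)
    also have "u powr m = C powr m * card (calM n) * h n powr m"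
      using C h m by (simp add: u_def Mc_def powr_mult powr_powr)
    also have "card (calM n) * (\<kappa> * D powr (m / 2) * h n powr m / (C powr m * card (calM n) * h n powr m))
        = \<kappa> * D powr (m / 2) / C powr m"
      using card h by simp
    also have "\<dots> = e / 2" using C \<kappa> D e by simp
    finally have PB: "prob B \<le> e / 2" .
    have "{\<omega> \<in> space PS.
      \<bar>Max ((\<lambda>i. \<bar>(Mm n *\<^sub>v theta_hat (b n) (tt n \<omega>)) $ i - (Mm n *\<^sub>v \<beta> n) $ i\<bar>) ` {..<p1 n})\<bar> > C' * (Mc n * h n)}
      \<subseteq> exceed n \<union> B"
    proof (rule ccontr)
      define err where "err \<omega> i = (Mm n *\<^sub>v theta_hat (b n) (tt n \<omega>)) $ i - (Mm n *\<^sub>v \<beta> n) $ i" for \<omega> i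
      assume "\<not> ?thesis"
      then obtain \<omega> where \<omega>: "\<omega> \<in> space PS" "\<omega> \<notin> exceed n" "\<omega> \<notin> B"
        and big: "\<bar>Max ((\<lambda>i. \<bar>err \<omega> i\<bar>) ` {..<p1 n})\<bar> > C' * (Mc n * h n)" by (auto simp: err_def)
      have "Max ((\<lambda>i. \<bar>err \<omega> i\<bar>) ` {..<p1 n}) \<in> (\<lambda>i. \<bar>err \<omega> i\<bar>) ` {..<p1 n}"
        using p1 by (intro Max_in) auto
      then obtain i where i: "i < p1 n" and eq: "Max ((\<lambda>i. \<bar>err \<omega> i\<bar>) ` {..<p1 n}) = \<bar>err \<omega> i\<bar>" by auto
      have sel: "Nset (b n) (tt n \<omega>) = N n" using elim(8) \<omega> by blast
      have err: "err \<omega> i = R.bias n (cc n i) + noise n (cc n i) \<omega>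
          - (\<Sum>j\<in>{..<p n} - N n. Mm n $$ (i, j) * R.theta n $ j) - (\<Sum>j<p n. Mm n $$ (i, j) * proj (Qp n) (\<beta> n) $ j)"
        unfolding err_def by (rule R.gamma_error[OF Mm_carrier i sel])
      have "\<bar>R.bias n (cc n i)\<bar> \<le> c * sqrt D * h n \<and> \<bar>noise n (cc n i) \<omega>\<bar> \<le> u"
      proof (cases "i \<in> calM n")
        case True
        have "(R.bias n (cc n i))\<^sup>2 \<le> (c * h n)\<^sup>2 * D"
          using elim(6) cn[OF True] unfolding h_def by blast
        also have "\<dots> = (c * sqrt D * h n)\<^sup>2" using D by (simp add: power_mult_distrib)
        finally have "\<bar>R.bias n (cc n i)\<bar> \<le> c * sqrt D * h n"
          using c h D power2_le_imp_le[of "\<bar>R.bias n (cc n i)\<bar>" "c * sqrt D * h n"] by simp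
        then show ?thesis using True \<omega> by (force simp: B_def)
      next
        case False
        then have "\<not> (\<Sum>k<r n. (cc n i k)\<^sup>2) > 0"
          using i Mm_carrier[of n] R.Q_carrier[of n] by (auto simp: Mset_def)
        then have "(\<Sum>k<r n. (cc n i k)\<^sup>2) = 0" by (simp add: sum_nonneg antisym not_less)
        then have "\<forall>k<r n. cc n i k = 0" by (subst (asm) sum_nonneg_eq_0_iff) auto
        then show ?thesis using u c h D by (simp add: R.bias_def R.noise_coef_def)
      qed
      then have "\<bar>err \<omega> i\<bar> \<le> c * sqrt D * h n + u + h n + h n"
        unfolding err using rem[OF i] by linarith
      also have "\<dots> = (c * sqrt D + 2) * h n * 1 + u" by (simp add: algebra_simps)
      also have "\<dots> \<le> (c * sqrt D + 2) * h n * Mc n + u"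
        using Mc h c D by (intro add_right_mono mult_left_mono) auto
      also have "\<dots> = C' * (Mc n * h n)" by (simp add: C'_def u_def algebra_simps)
      finally show False using big eq by simp
    qed
    then have "prob {\<omega> \<in> space PS.
      \<bar>Max ((\<lambda>i. \<bar>(Mm n *\<^sub>v theta_hat (b n) (tt n \<omega>)) $ i - (Mm n *\<^sub>v \<beta> n) $ i\<bar>) ` {..<p1 n})\<bar> > C' * (Mc n * h n)}
      \<le> prob (exceed n \<union> B)"
      using exceed_events B by (intro finite_measure_mono) auto
    also have "\<dots> \<le> prob (exceed n) + prob B" using exceed_events B by (intro measure_Un_le) auto
    finally show ?case using PB elim(5) by linarith
  qed
  then show "\<exists>C K. \<forall>n\<ge>K. prob {\<omega> \<in> space PS.
      \<bar>Max ((\<lambda>i. \<bar>(Mm n *\<^sub>v theta_hat (b n) (tt n \<omega>)) $ i - (Mm n *\<^sub>v \<beta> n) $ i\<bar>) ` {..<p1 n})\<bar>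
        > C * (real (card (calM n)) powr (1 / m) * real n powr (- \<eta>))} \<le> e"
    unfolding eventually_sequentially Mc_def h_def by blast
qed

text \<open>With \<open>t n\<close> the target rate, every term of \<open>W\<close> has mean of
  order at most \<open>t n\<close>: the averages of centred squares and of the errors against
  \<open>x\<close> have variances of order \<open>1 / n\<close> and \<open>t n / n\<close>, the
  bound \<open>dq\<close> on selected coordinates has mean of order \<open>(t n)\<^sup>2\<close>,
  and the deleted signal has square sum of order \<open>t n\<close>. Since
  \<open>\<alpha>\<sigma> \<le> \<eta> \<le> 1/2\<close>, also
  \<open>1 / n \<le> (t n)\<^sup>2\<close>.\<close>

lemma sigma_bigOp:
  fixes \<alpha>\<sigma> :: real
  assumes \<alpha>\<sigma>: "0 < \<alpha>\<sigma>" "\<alpha>\<sigma> \<le> \<eta>"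
    and l1: "(\<lambda>n. real n powr (- \<nu>b) * (\<Sum>j\<in>{..<p n} - N n. \<bar>R.theta n $ j\<bar>)) \<in> O(\<lambda>n. real n powr (- \<alpha>\<sigma>))"
    and cardN: "(\<lambda>n. sqrt (real (card (N n))) / real n powr \<eta>) \<in> O(\<lambda>n. real n powr (- \<alpha>\<sigma>))"
  shows "bigOp PS (\<lambda>n \<omega>. \<bar>sigma_hat2 (X n) (R.resp n (\<lambda>l. eps l \<omega>)) (theta_hat (b n) (tt n \<omega>))
      - expectation (\<lambda>\<omega>. (eps 0 \<omega>)\<^sup>2)\<bar>) (\<lambda>n. real n powr (- \<alpha>\<sigma>))"
proof -
  define s2 where "s2 = expectation (\<lambda>\<omega>. (eps 0 \<omega>)\<^sup>2)"
  define L where "L = Clam\<^sup>2"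
  have L: "L > 0" using Clam_pos by (simp add: L_def)
  have s2: "s2 \<ge> 0" by (simp add: s2_def)
  obtain c where c: "c > 0" and scale: "\<forall>\<^sub>F n in sequentially. n > 0 \<and> (\<forall>d D. (\<Sum>k<r n. (d k)\<^sup>2) \<le> D \<longrightarrow>
    (\<Sum>l<n. (R.noise_coef n d l)\<^sup>2) \<le> (c * real n powr (- \<eta>))\<^sup>2 * D
    \<and> (R.bias n d)\<^sup>2 \<le> (c * real n powr (- \<eta>))\<^sup>2 * D)" by (rule bias_noise_scale)
  obtain c1 where c1: "c1 > 0" "\<forall>\<^sub>F n in sequentially.
      norm (real n powr (- \<nu>b) * (\<Sum>j\<in>{..<p n} - N n. \<bar>R.theta n $ j\<bar>)) \<le> c1 * norm (real n powr (- \<alpha>\<sigma>))"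
    using l1 by (elim landau_o.bigE)
  obtain c2 where c2: "c2 > 0" "\<forall>\<^sub>F n in sequentially.
      norm (sqrt (real (card (N n))) / real n powr \<eta>) \<le> c2 * norm (real n powr (- \<alpha>\<sigma>))"
    using cardN by (elim landau_o.bigE)
  obtain K where K: "K > 0" "\<And>a n. integrable PS (\<lambda>\<omega>. (\<Sum>l<n. a l * eps l \<omega>)\<^sup>2)"
    "\<And>a n V. V > 0 \<Longrightarrow> (\<Sum>l<n. (a l)\<^sup>2) \<le> V \<Longrightarrow>
      expectation (\<lambda>\<omega>. (\<Sum>l<n. a l * eps l \<omega>)\<^sup>2) \<le> K * V"
    by (rule second_moment_linear_combination[OF indep_eps eps_integrable eps_expectation
          eps_square_integrable eq_refl[OF eps_square_expectation]]) blast
  have i4: "integrable PS (\<lambda>\<omega>. ((eps i \<omega>)\<^sup>2 - s2)\<^sup>2)" for i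
  proof -
    have "integrable PS (\<lambda>\<omega>. \<bar>eps 0 \<omega>\<bar> powr 4)"
      by (rule integrable_powr_le[OF eps_rv eps_moment]) (use m in auto)
    moreover have "\<bar>x\<bar> powr 4 = (x\<^sup>2)\<^sup>2" for x :: real by (cases "x = 0") auto
    ultimately have "integrable PS (\<lambda>\<omega>. ((eps 0 \<omega>)\<^sup>2)\<^sup>2)" by simp
    then have "integrable PS (\<lambda>\<omega>. ((eps 0 \<omega>)\<^sup>2)\<^sup>2 + s2\<^sup>2 - 2 * (eps 0 \<omega>)\<^sup>2 * s2)"
      using eps_square_integrable[of 0] by auto
    then have "integrable PS (\<lambda>\<omega>. ((eps 0 \<omega>)\<^sup>2 - s2)\<^sup>2)" by (simp only: power2_diff)
    then show ?thesis using eps_identical(1)[of "\<lambda>x. (x\<^sup>2 - s2)\<^sup>2" i] by simp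
  qed
  have e4: "expectation (\<lambda>\<omega>. ((eps i \<omega>)\<^sup>2 - s2)\<^sup>2) \<le> expectation (\<lambda>\<omega>. ((eps 0 \<omega>)\<^sup>2 - s2)\<^sup>2)" for i
    by (rule eq_refl[OF eps_identical(2)]) simp
  have ind2: "indep_vars (\<lambda>_. borel) (\<lambda>i \<omega>. (eps i \<omega>)\<^sup>2 - s2) UNIV"
    by (rule indep_vars_compose2[OF indep_eps]) simp
  have E2: "integrable PS (\<lambda>\<omega>. (eps i \<omega>)\<^sup>2 - s2)" "expectation (\<lambda>\<omega>. (eps i \<omega>)\<^sup>2 - s2) = 0" for i
    using eps_square_integrable[of i] eps_square_expectation[of i] by (auto simp: s2_def prob_space)
  obtain K' where K': "K' > 0" "\<And>a n. integrable PS (\<lambda>\<omega>. (\<Sum>l<n. a l * ((eps l \<omega>)\<^sup>2 - s2))\<^sup>2)"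
    "\<And>a n V. V > 0 \<Longrightarrow> (\<Sum>l<n. (a l)\<^sup>2) \<le> V \<Longrightarrow>
      expectation (\<lambda>\<omega>. (\<Sum>l<n. a l * ((eps l \<omega>)\<^sup>2 - s2))\<^sup>2) \<le> K' * V"
    by (rule second_moment_linear_combination[OF ind2 E2 i4 e4]) blast
  \<comment> \<open>Off \<open>N n\<close> one factor of each square is at most
    \<open>cb * b n\<close>, so the weighted sum of absolute values controls the sum of
    squares.\<close>
  define T where "T = cb * Cb * c1"
  have T: "T > 0" using cb Cb c1 by (simp add: T_def)
  \<comment> \<open>Per selected coordinate the mean square error is bounded by
    \<open>2 * c\<^sup>2 + 2 * (K * c\<^sup>2)\<close> times
    \<open>(n powr (- \<eta>))\<^sup>2\<close>; \<open>c2\<^sup>2\<close> comes from the number of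
    selected coordinates.\<close>
  define G where "G = c2\<^sup>2 * (2 * c\<^sup>2 + 2 * (K * c\<^sup>2))"
  have G: "G > 0" using c c2 K by (simp add: G_def add_pos_pos)
  define t where "t n = real n powr (- \<alpha>\<sigma>)" for n :: nat
  define tsq where "tsq n = (\<Sum>j\<in>{..<p n} - N n. (R.theta n $ j)\<^sup>2)" for n
  define x where "x n l = (X n *\<^sub>v R.small_part n (b n)) $ l" for n l
  define U1 where "U1 n \<omega> = (\<Sum>l<n. 1 * ((eps l \<omega>)\<^sup>2 - s2))\<^sup>2" for n \<omega>
  define U2 where "U2 n \<omega> = (\<Sum>l<n. x n l * eps l \<omega>)\<^sup>2" for n \<omega>
  define U3 where "U3 n \<omega> = (\<Sum>l<n. (eps l \<omega>)\<^sup>2)" for n \<omega>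
  define dq where "dq n \<omega> = (\<Sum>j\<in>N n. 2 * (R.bias n (R.row n j))\<^sup>2 + 2 * (noise n (R.row n j) \<omega>)\<^sup>2)" for n \<omega>
  \<comment> \<open>\<open>dq\<close> stands in for the squared estimation errors, split into
    squares of bias and noise, so that integrability and mean of \<open>W\<close> can be read
    off.\<close>
  define W where "W n \<omega> = (t n + U1 n \<omega> / (real n)\<^sup>2 / t n) / 2 + (t n + U2 n \<omega> / (real n)\<^sup>2 / t n)
      + (t n * U3 n \<omega> / real n + L * dq n \<omega> / t n) + 2 * L * (dq n \<omega> + tsq n)" for n \<omega>
  define C where "C = (1 + K') / 2 + (1 + K * L * T) + (s2 + L * G) + 2 * L * (G + T)"
  have tn: "t n \<ge> 0" for n by (simp add: t_def)
  have lamL: "(lam n k)\<^sup>2 \<le> L * n" if "\<forall>k<r n. clam * real n powr \<eta> \<le> lam n k \<and> lam n k \<le> Clam * sqrt (real n)" "k < r n" for n k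
  proof -
    have "(lam n k)\<^sup>2 \<le> (Clam * sqrt (real n))\<^sup>2"
      using that R.lam_pos[of k n] by (intro power_mono) auto
    then show ?thesis by (simp add: L_def power_mult_distrib)
  qed
  have "bigOp PS (\<lambda>n \<omega>. \<bar>sigma_hat2 (X n) (R.resp n (\<lambda>l. eps l \<omega>)) (theta_hat (b n) (tt n \<omega>)) - s2\<bar>) t"
  proof (rule bigOpI_expectation[where W = W and C = C])
    show "\<forall>\<^sub>F n in sequentially. 0 < t n"
      using eventually_gt_at_top[of 0] by eventually_elim (simp add: t_def)
    show "\<forall>\<^sub>F n in sequentially. \<forall>\<omega>\<in>space PS - exceed n.
        \<bar>\<bar>sigma_hat2 (X n) (R.resp n (\<lambda>l. eps l \<omega>)) (theta_hat (b n) (tt n \<omega>)) - s2\<bar>\<bar> \<le> W n \<omega>"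
      using selection_consistent lam_bounds eventually_gt_at_top[of 0]
    proof eventually_elim
      case (elim n)
      show ?case
      proof
        fix \<omega> assume "\<omega> \<in> space PS - exceed n"
        then have sel: "Nset (b n) (tt n \<omega>) = N n" using elim(1) by blast
        define q where "q = (\<Sum>j\<in>N n. (tt n \<omega> $ j - R.theta n $ j)\<^sup>2)"
        have q: "q \<le> dq n \<omega>" unfolding q_def dq_def
        proof (rule sum_mono)
          fix j assume "j \<in> N n"
          then have j: "j < p n" using R.Nset_subset by blast
          have "(u + v)\<^sup>2 \<le> 2 * u\<^sup>2 + 2 * v\<^sup>2" for u v :: real
          proof -
            have "0 \<le> (u - v)\<^sup>2" by simp
            then show ?thesis by (simp add: power2_eq_square algebra_simps)
          qed
          then show "(tt n \<omega> $ j - R.theta n $ j)\<^sup>2 \<le> 2 * (R.bias n (R.row n j))\<^sup>2 + 2 * (noise n (R.row n j) \<omega>)\<^sup>2"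
            unfolding R.tt_error[OF j] .
        qed
        have tpos: "t n > 0" using elim(3) by (simp add: t_def)
        have "\<bar>sigma_hat2 (X n) (R.resp n (\<lambda>l. eps l \<omega>)) (theta_hat (b n) (tt n \<omega>)) - s2\<bar> \<le>
           (t n + ((\<Sum>l<n. (eps l \<omega>)\<^sup>2 - s2) / n)\<^sup>2 / t n) / 2
           + (t n + ((\<Sum>l<n. x n l * eps l \<omega>) / n)\<^sup>2 / t n)
           + (t n * (\<Sum>l<n. (eps l \<omega>)\<^sup>2) / n + L * q / t n) + 2 * L * (q + tsq n)"
          unfolding q_def tsq_def x_def
          by (rule R.sigma_error[OF sel tpos elim(3) lamL[OF elim(2)] less_imp_le[OF L]])
        also have "\<dots> \<le> (t n + ((\<Sum>l<n. (eps l \<omega>)\<^sup>2 - s2) / n)\<^sup>2 / t n) / 2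
           + (t n + ((\<Sum>l<n. x n l * eps l \<omega>) / n)\<^sup>2 / t n)
           + (t n * (\<Sum>l<n. (eps l \<omega>)\<^sup>2) / n + L * dq n \<omega> / t n) + 2 * L * (dq n \<omega> + tsq n)"
          using q L tpos by (intro add_mono order_refl divide_right_mono mult_left_mono) auto
        finally show "\<bar>\<bar>sigma_hat2 (X n) (R.resp n (\<lambda>l. eps l \<omega>)) (theta_hat (b n) (tt n \<omega>)) - s2\<bar>\<bar> \<le> W n \<omega>"
          by (simp add: W_def U1_def U2_def U3_def power_divide)
      qed
    qed
    show "\<forall>\<^sub>F n in sequentially. integrable PS (W n) \<and> (\<forall>\<omega>. 0 \<le> W n \<omega>) \<and> expectation (W n) \<le> C * t n"
      using scale c1(2) c2(2) lam_bounds separation eventually_gt_at_top[of 0]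
    proof eventually_elim
      case (elim n)
      define h where "h = real n powr (- \<eta>)"
      have n: "n > 0" using elim(6) .
      have t: "t n > 0" "t n \<le> 1" using n \<alpha>\<sigma> by (auto simp: t_def powr_le_one_le powr_minus_divide ge_one_powr_ge_zero)
      have int: "integrable PS (U1 n)" "integrable PS (U2 n)" "integrable PS (U3 n)" "integrable PS (dq n)"
        unfolding U1_def[abs_def] U2_def[abs_def] U3_def[abs_def] dq_def[abs_def]
        using K(2) K'(2)[of "\<lambda>_. 1"] eps_square_integrable by auto
      have intW: "integrable PS (W n)" unfolding W_def[abs_def] using int by simp
      have nn: "tsq n \<ge> 0" "dq n \<omega> \<ge> 0" "U1 n \<omega> \<ge> 0" "U2 n \<omega> \<ge> 0" "U3 n \<omega> \<ge> 0" for \<omega>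
        by (auto simp: tsq_def dq_def U1_def U2_def U3_def intro!: sum_nonneg)
      have W0: "0 \<le> W n \<omega>" for \<omega>
        unfolding W_def using nn tn[of n] L by (intro add_nonneg_nonneg divide_nonneg_nonneg mult_nonneg_nonneg) auto
      have EU1: "expectation (U1 n) \<le> K' * real n"
        unfolding U1_def[abs_def] using n by (intro K'(3)) auto
      have tsq: "tsq n \<le> T * t n"
      proof -
        have "tsq n \<le> (\<Sum>j\<in>{..<p n} - N n. cb * b n * \<bar>R.theta n $ j\<bar>)"
          unfolding tsq_def
        proof (rule sum_mono)
          fix j assume "j \<in> {..<p n} - N n"
          then have "\<bar>R.theta n $ j\<bar> \<le> cb * b n" using elim(5) by blast
          then have "\<bar>R.theta n $ j\<bar> * \<bar>R.theta n $ j\<bar> \<le> cb * b n * \<bar>R.theta n $ j\<bar>"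
            by (rule mult_right_mono) simp
          then show "(R.theta n $ j)\<^sup>2 \<le> cb * b n * \<bar>R.theta n $ j\<bar>" by (simp add: power2_eq_square)
        qed
        also have "\<dots> = cb * Cb * (real n powr (- \<nu>b) * (\<Sum>j\<in>{..<p n} - N n. \<bar>R.theta n $ j\<bar>))"
          by (simp add: b_eq sum_distrib_left mult_ac)
        also have "\<dots> \<le> cb * Cb * (c1 * t n)"
          using elim(2) cb Cb by (intro mult_left_mono) (auto simp: t_def)
        finally show ?thesis by (simp add: T_def mult_ac)
      qed
      have EU2: "expectation (U2 n) \<le> K * (L * real n * (T * t n))"
        unfolding U2_def[abs_def]
      proof (rule K(3))
        have "(\<Sum>l<n. (x n l)\<^sup>2) \<le> L * real n * (\<Sum>j<p n. (R.small_part n (b n) $ j)\<^sup>2)"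
          unfolding x_def by (rule R.X_norm_le) (use lamL[OF elim(4)] L in \<open>auto simp: R.small_part_def\<close>)
        also have "\<dots> \<le> L * real n * (T * t n)"
          unfolding R.small_part_sq_sum using tsq L by (intro mult_left_mono) (auto simp: tsq_def)
        finally show "(\<Sum>l<n. (x n l)\<^sup>2) \<le> L * real n * (T * t n)" .
      qed (use L T t n in simp)
      have EU3: "expectation (U3 n) = real n * s2"
      proof -
        have "expectation (\<lambda>\<omega>. (eps l \<omega>)\<^sup>2) = s2" for l
          using eps_square_expectation[of l] by (simp add: s2_def)
        then show ?thesis unfolding U3_def[abs_def] using eps_square_integrable by simp
      qed
      have Edq: "expectation (dq n) \<le> G * (t n)\<^sup>2"
      proof -
        have ch: "c * h > 0" using c n by (simp add: h_def)
        have "expectation (dq n) = (\<Sum>j\<in>N n. 2 * (R.bias n (R.row n j))\<^sup>2 + 2 * expectation (\<lambda>\<omega>. (noise n (R.row n j) \<omega>)\<^sup>2))"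
          unfolding dq_def[abs_def] using K(2) by (simp add: prob_space)
        also have "\<dots> \<le> (\<Sum>j\<in>N n. 2 * (c * h)\<^sup>2 + 2 * (K * (c * h)\<^sup>2))"
        proof (rule sum_mono)
          fix j assume "j \<in> N n"
          then have j: "j < p n" using R.Nset_subset by blast
          have "(\<Sum>k<r n. (R.row n j k)\<^sup>2) \<le> 1"
            using R.Q_row_norm_le[OF j] by (simp add: R.row_def)
          then have 1: "(\<Sum>l<n. (R.noise_coef n (R.row n j) l)\<^sup>2) \<le> (c * h)\<^sup>2 * 1"
            "(R.bias n (R.row n j))\<^sup>2 \<le> (c * h)\<^sup>2 * 1"
            using elim(1) unfolding h_def by blast+
          then have "expectation (\<lambda>\<omega>. (noise n (R.row n j) \<omega>)\<^sup>2) \<le> K * (c * h)\<^sup>2"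
            using ch by (intro K(3)) auto
          then show "2 * (R.bias n (R.row n j))\<^sup>2 + 2 * expectation (\<lambda>\<omega>. (noise n (R.row n j) \<omega>)\<^sup>2)
            \<le> 2 * (c * h)\<^sup>2 + 2 * (K * (c * h)\<^sup>2)" using 1(2) by simp
        qed
        also have "\<dots> = card (N n) * h\<^sup>2 * (2 * c\<^sup>2 + 2 * (K * c\<^sup>2))"
          by (simp add: power_mult_distrib algebra_simps)
        also have "card (N n) * h\<^sup>2 = (sqrt (card (N n)) / real n powr \<eta>)\<^sup>2"
          by (simp add: h_def power_mult_distrib powr_minus divide_inverse)
        also have "\<dots> \<le> (c2 * t n)\<^sup>2"
          using elim(3) by (intro power_mono) (auto simp: t_def)
        finally show ?thesis using c K by (simp add: G_def power_mult_distrib mult_ac mult_right_mono)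
      qed
      have inv_n: "1 / real n \<le> t n * t n"
      proof -
        have "1 / real n = real n powr (- 1)" using n by (simp add: powr_minus_divide)
        also have "\<dots> \<le> real n powr (- \<alpha>\<sigma> + - \<alpha>\<sigma>)" using n \<alpha>\<sigma> \<eta> by (intro powr_mono) auto
        finally show ?thesis by (simp add: t_def flip: powr_add)
      qed
      have tt: "t n * t n \<le> t n" using t by (simp add: mult_left_le)
      have b1: "expectation (U1 n) / (real n)\<^sup>2 / t n \<le> K' * t n"
      proof -
        have "expectation (U1 n) / (real n)\<^sup>2 / t n \<le> K' * real n / (real n)\<^sup>2 / t n"
          using EU1 t by (intro divide_right_mono) auto
        also have "\<dots> = K' * (1 / real n) / t n" using n by (simp add: power2_eq_square)
        also have "\<dots> \<le> K' * (t n * t n) / t n" using inv_n K' t by (intro divide_right_mono mult_left_mono) auto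
        finally show ?thesis using t by simp
      qed
      have b2: "expectation (U2 n) / (real n)\<^sup>2 / t n \<le> K * L * T * t n"
      proof -
        have "expectation (U2 n) / (real n)\<^sup>2 / t n \<le> K * (L * real n * (T * t n)) / (real n)\<^sup>2 / t n"
          using EU2 t by (intro divide_right_mono) auto
        also have "\<dots> = K * L * T * (1 / real n)" using n t by (simp add: power2_eq_square)
        also have "\<dots> \<le> K * L * T * t n" using inv_n tt K L T by (intro mult_left_mono) auto
        finally show ?thesis .
      qed
      have b3: "t n * expectation (U3 n) / real n = s2 * t n" using n by (simp add: EU3)
      have b4: "L * expectation (dq n) / t n \<le> L * G * t n"
      proof -
        have "L * expectation (dq n) / t n \<le> L * (G * (t n)\<^sup>2) / t n"
          using Edq L t by (intro divide_right_mono mult_left_mono) auto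
        then show ?thesis using t by (simp add: power2_eq_square)
      qed
      have "G * (t n)\<^sup>2 \<le> G * t n" using tt G by (simp add: power2_eq_square)
      then have b5: "2 * L * (expectation (dq n) + tsq n) \<le> 2 * L * (G * t n + T * t n)"
        using Edq tsq L by (intro mult_left_mono add_mono) auto
      have "expectation (W n) = (t n + expectation (U1 n) / (real n)\<^sup>2 / t n) / 2 + (t n + expectation (U2 n) / (real n)\<^sup>2 / t n)
          + (t n * expectation (U3 n) / real n + L * expectation (dq n) / t n) + 2 * L * (expectation (dq n) + tsq n)"
        unfolding W_def[abs_def] using int by (simp add: prob_space)
      also have "\<dots> \<le> (t n + K' * t n) / 2 + (t n + K * L * T * t n) + (s2 * t n + L * G * t n) + 2 * L * (G * t n + T * t n)"
        using b1 b2 b4 b5 unfolding b3 by (intro add_mono divide_right_mono order_refl) auto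
      also have "\<dots> = C * t n" by (simp add: C_def algebra_simps add_divide_distrib)
      finally show ?case using intW W0 by simp
    qed
  qed (use exceed_events prob_exceed_tendsto in auto)
  then show ?thesis by (simp add: s2_def t_def[abs_def])
qed

end

section \<open>Transfer to the notation of the theorem\<close>

theorem theorem1:
  fixes PS :: "'a measure" and eps :: "nat \<Rightarrow> 'a \<Rightarrow> real"
    and p r p1 :: "nat \<Rightarrow> nat"
    and X P Q Qp Mm :: "nat \<Rightarrow> real mat"
    and \<beta> :: "nat \<Rightarrow> real vec"
    and lam :: "nat \<Rightarrow> nat \<Rightarrow> real"
    and \<rho> b :: "nat \<Rightarrow> real"
    and Lam :: "nat \<Rightarrow> real mat" and \<theta> \<theta>perp \<gamma> :: "nat \<Rightarrow> real vec"
    and N calM :: "nat \<Rightarrow> nat set" and c :: "nat \<Rightarrow> nat \<Rightarrow> nat \<Rightarrow> real"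
    and y \<theta>t \<theta>h \<gamma>h :: "nat \<Rightarrow> 'a \<Rightarrow> real vec" and Nhat :: "nat \<Rightarrow> 'a \<Rightarrow> nat set"
    and \<sigma>h2 :: "nat \<Rightarrow> 'a \<Rightarrow> real" and \<sigma>2 :: real
    and \<eta> \<alpha>\<theta> clam Clam \<delta> m \<alpha>p Cb \<nu>b cb \<alpha>M cM CM \<alpha>\<sigma> :: real
  assumes defs: "Lam = (\<lambda>n. diagm (r n) (lam n))"
      and "\<theta> = (\<lambda>n. proj (Q n) (\<beta> n))"
      and "\<theta>perp = (\<lambda>n. proj (Qp n) (\<beta> n))"
      and "N = (\<lambda>n. Nset (b n) (\<theta> n))"
      and "c = (\<lambda>n. ccoef (Mm n) (Q n) (N n))"
      and "calM = (\<lambda>n. Mset (Mm n) (Q n) (N n))"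
      and "\<gamma> = (\<lambda>n. Mm n *\<^sub>v \<beta> n)"
      and "y = (\<lambda>n \<omega>. yvec (X n) (\<beta> n) eps \<omega>)"
      and "\<theta>t = (\<lambda>n \<omega>. theta_tilde (X n) (Q n) (Lam n) (\<rho> n) (y n \<omega>))"
      and "Nhat = (\<lambda>n \<omega>. Nset (b n) (\<theta>t n \<omega>))"
      and "\<theta>h = (\<lambda>n \<omega>. theta_hat (b n) (\<theta>t n \<omega>))"
      and "\<gamma>h = (\<lambda>n \<omega>. Mm n *\<^sub>v \<theta>h n \<omega>)"
      and "\<sigma>h2 = (\<lambda>n \<omega>. sigma_hat2 (X n) (y n \<omega>) (\<theta>h n \<omega>))"
      and "\<sigma>2 = lebesgue_integral PS (\<lambda>\<omega>. (eps 0 \<omega>)^2)"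
  \<comment> \<open>Model: deterministic design X n (n x p n), parameter, contrast matrix, thin SVD\<close>
    and dims: "\<And>n. X n \<in> carrier_mat n (p n)" "\<And>n. \<beta> n \<in> carrier_vec (p n)"
      "\<And>n. Mm n \<in> carrier_mat (p1 n) (p n)"
    and svd: "\<And>n. P n \<in> carrier_mat n (r n)" "\<And>n. Q n \<in> carrier_mat (p n) (r n)"
      "\<And>n. X n = P n * Lam n * transpose_mat (Q n)"
      "\<And>n. transpose_mat (P n) * P n = 1\<^sub>m (r n)"
      "\<And>n. transpose_mat (Q n) * Q n = 1\<^sub>m (r n)"
      "\<And>n i j. i \<le> j \<Longrightarrow> j < r n \<Longrightarrow> lam n j \<le> lam n i"
      "\<And>n k. k < r n \<Longrightarrow> lam n k > 0"
    and perp: "\<And>n. Qp n \<in> carrier_mat (p n) (p n - r n)"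
      "\<And>n. transpose_mat (Qp n) * Qp n = 1\<^sub>m (p n - r n)"
      "\<And>n. transpose_mat (Q n) * Qp n = 0\<^sub>m (r n) (p n - r n)"
      "\<And>n. Q n * transpose_mat (Q n) + Qp n * transpose_mat (Qp n) = 1\<^sub>m (p n)"
  \<comment> \<open>Assumption 1\<close>
    and A1: "clam > 0" "Clam > 0" "0 < \<eta>" "\<eta> \<le> 1/2"
      "\<forall>\<^sub>F n in sequentially. (\<forall>k<r n. clam * real n powr \<eta> \<le> lam n k \<and> lam n k \<le> Clam * sqrt (real n))"
      "(\<lambda>n. vnorm (\<theta> n)) \<in> O(\<lambda>n. real n powr \<alpha>\<theta>)" "0 < \<alpha>\<theta>" "\<alpha>\<theta> < 3 * \<eta>"
  \<comment> \<open>Assumption 2\<close>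
    and A2: "\<And>n. \<rho> n > 0" "\<rho> \<in> O(\<lambda>n. real n powr (2 * \<eta> - \<delta>))"
      "(\<eta> + \<alpha>\<theta>) / 2 < \<delta>" "\<delta> < 2 * \<eta>"
  \<comment> \<open>Assumption 3\<close>
    and A3: "prob_space PS" "\<And>i. eps i \<in> borel_measurable PS"
      "prob_space.indep_vars PS (\<lambda>_. borel) eps UNIV"
      "\<And>i. distr PS borel (eps i) = distr PS borel (eps 0)"
      "integrable PS (eps 0)" "lebesgue_integral PS (eps 0) = 0"
      "m > 4" "integrable PS (\<lambda>\<omega>. \<bar>eps 0 \<omega>\<bar> powr m)"
  \<comment> \<open>Assumption 4\<close>
    and A4: "(\<lambda>n. real (p n)) \<in> O(\<lambda>n. real n powr \<alpha>p)" "0 \<le> \<alpha>p" "\<alpha>p < m * \<eta>"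
      "\<And>n. b n = Cb * real n powr (- \<nu>b)" "Cb > 0" "\<nu>b > 0" "\<nu>b + \<alpha>p / m - \<eta> < 0"
      "0 < cb" "cb < 1"
      "\<forall>\<^sub>F n in sequentially. (\<forall>i<p n. (i \<notin> N n \<longrightarrow> \<bar>\<theta> n $ i\<bar> \<le> cb * b n)
                                         \<and> (i \<in> N n \<longrightarrow> \<bar>\<theta> n $ i\<bar> \<ge> b n / cb))"
  \<comment> \<open>Assumption 5\<close>
    and A5: "\<forall>\<^sub>F n in sequentially. calM n \<noteq> {}"
      "(\<lambda>n. real (card (calM n))) \<in> O(\<lambda>n. real n powr \<alpha>M)" "\<alpha>M < m * \<eta>"
      "0 < cM" "\<forall>\<^sub>F n in sequentially. (\<forall>i\<in>calM n. cM < (\<Sum>k<r n. (c n i k)^2)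
                                                  \<and> (\<Sum>k<r n. (c n i k)^2) \<le> CM)"
      "(\<lambda>n. Max ((\<lambda>i. \<bar>\<Sum>j\<in>{..<p n} - N n. Mm n $$ (i,j) * \<theta> n $ j\<bar>) ` {..<p1 n}))
          \<in> o(\<lambda>n. 1 / sqrt (real n * ln (real n)))"
      "(\<lambda>n. Max ((\<lambda>i. \<bar>\<Sum>j<p n. Mm n $$ (i,j) * \<theta>perp n $ j\<bar>) ` {..<p1 n}))
          \<in> o(\<lambda>n. 1 / sqrt (real n * ln (real n)))"
  shows "(\<lambda>n. measure PS {\<omega> \<in> space PS. Nhat n \<omega> \<noteq> N n})
            \<in> O(\<lambda>n. real n powr (\<alpha>p + m * \<nu>b - m * \<eta>))
       \<and> bigOp PS (\<lambda>n \<omega>. Max ((\<lambda>i. \<bar>\<gamma>h n \<omega> $ i - \<gamma> n $ i\<bar>) ` {..<p1 n}))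
                  (\<lambda>n. real (card (calM n)) powr (1 / m) * real n powr (- \<eta>))
       \<and> ((0 < \<alpha>\<sigma> \<and> \<alpha>\<sigma> \<le> \<eta>
           \<and> (\<lambda>n. real n powr (- \<nu>b) * (\<Sum>j\<in>{..<p n} - N n. \<bar>\<theta> n $ j\<bar>)) \<in> O(\<lambda>n. real n powr (- \<alpha>\<sigma>))
           \<and> (\<lambda>n. sqrt (real (card (N n))) / real n powr \<eta>) \<in> O(\<lambda>n. real n powr (- \<alpha>\<sigma>)))
          \<longrightarrow> bigOp PS (\<lambda>n \<omega>. \<bar>\<sigma>h2 n \<omega> - \<sigma>2\<bar>) (\<lambda>n. real n powr (- \<alpha>\<sigma>)))"
proof -
  interpret prob_space PS by (rule A3(1))
  have N_eq: "N n = Nset (b n) (proj (Q n) (\<beta> n))" for n by (simp add: assms(2,4))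
  have design: "ridge_design n (p n) (r n) (X n) (P n) (Q n) (Qp n) (lam n) (\<rho> n) (\<beta> n)" for n
    by (rule ridge_design.intro)
       (fact dims(1) dims(2) svd(1,2,4,5) svd(3)[unfolded defs] svd(7) perp(1) perp(4) A2(1))+
  interpret A: ridge_asymptotics PS eps p r p1 X P Q Qp Mm \<beta> lam \<rho> b \<eta> \<alpha>\<theta> clam Clam \<delta> m \<alpha>p Cb \<nu>b cb
    by (intro ridge_asymptotics.intro ridge_asymptotics_axioms.intro prob_space_axioms)
       (fact design dims(3) A1(1-5) A1(6)[unfolded assms(2)] A2(2,3) A3 A4(1,2,4,5,7-9)
         A4(10)[unfolded N_eq, unfolded assms(2)])+
  have y_eq: "y n \<omega> = A.R.resp n (\<lambda>l. eps l \<omega>)" for n \<omega>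
    using dims(1)[of n] by (simp add: assms(8) yvec_def)
  have tt_eq: "\<theta>t n \<omega> = A.tt n \<omega>" for n \<omega>
    by (simp add: assms(9) y_eq defs)
  \<comment> \<open>For large \<open>n\<close> a wrong selection can happen only inside
    \<open>exceed n\<close>, which is the set whose measurability is known.\<close>
  have "(\<lambda>n. prob {\<omega> \<in> space PS. Nhat n \<omega> \<noteq> N n}) \<in> O(\<lambda>n. prob (A.exceed n))"
  proof (rule landau_o.big_mono)
    show "\<forall>\<^sub>F n in sequentially. norm (prob {\<omega> \<in> space PS. Nhat n \<omega> \<noteq> N n}) \<le> norm (prob (A.exceed n))"
      using A.selection_consistent
    proof eventually_elim
      case (elim n)
      then have "{\<omega> \<in> space PS. Nhat n \<omega> \<noteq> N n} \<subseteq> A.exceed n"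
        by (auto simp: assms(10) tt_eq N_eq)
      then show ?case using A.exceed_events by (auto intro!: finite_measure_mono)
    qed
  qed
  then have 1: "(\<lambda>n. prob {\<omega> \<in> space PS. Nhat n \<omega> \<noteq> N n}) \<in> O(\<lambda>n. real n powr (\<alpha>p + m * \<nu>b - m * \<eta>))"
    using A.prob_exceed by (rule landau_o.big_trans)
  have 2: "bigOp PS (\<lambda>n \<omega>. Max ((\<lambda>i. \<bar>\<gamma>h n \<omega> $ i - \<gamma> n $ i\<bar>) ` {..<p1 n}))
      (\<lambda>n. real (card (calM n)) powr (1 / m) * real n powr (- \<eta>))"
  proof -
    have "\<forall>\<^sub>F n in sequentially. \<forall>i\<in>calM n. (\<Sum>k<r n. (c n i k)\<^sup>2) \<le> CM"
      by (rule eventually_mono[OF A5(5)]) blast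
    then show ?thesis
      using A.gamma_bigOp[where CM = CM] A5(1,6,7)
      by (simp add: assms(2,3,4,5,6,7,11,12) tt_eq)
  qed
  show ?thesis
    using 1 2 A.sigma_bigOp[of \<alpha>\<sigma>]
    by (simp add: assms(2,4,11,13,14) tt_eq y_eq)
qed

end
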